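(* Let $\{x^k\}_{k\ge0}$ be an infinite sequence generated by the regularized proximal Newton method (described in the context), with $r(x^k)\ne0$ for all $k$, and let $\mathcal K$ be the (infinite) set of iteration indices defined in the context. Suppose: (a) the set $X^*$ of strongly stationary points is nonempty and there exists an accumulation point $x^*\in X^*$ of the subsequence $\{x^k\}_{k\in\mathcal K}$; (b) there exist $\varepsilon>0$ and $L_\psi>0$ such that $\|\nabla^2\psi(Ax-b)-\nabla^2\psi(Ay-b)\|\le L_\psi\|Ax-Ay\|$ for all $x,y\in B_\varepsilon(x^* )\cap\operatorname{dom}\varphi$; (c) there exist $\beta>0$ and $q>\max\{\delta,1-\delta\}$ such that $\beta\operatorname{dist}(x,X^* )\le\|r(x)\|^q$ for all $x\in B_\varepsilon(x^* )\cap\operatorname{dom}\varphi$ (with $\delta$ the parameter of the algorithm and the same $\varepsilon$ as in (b)); and moreover $q>\frac{1}{1+\delta}$. Then $\{x^k\}$ converges to $x^*$, $\{\|r(x^k)\|\}$ converges to $0$ at the rate of $\rho:=\min\{1+\tau,\delta+q\}>1$, and $\{\operatorname{dist}(x^k,X^* )\}$ converges to $0$ at the rate of $(1+\delta)q>1$.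
   Context: Setting. Let $A\in\mathbb{R}^{m\times n}$, $b\in\mathbb{R}^m$, and let $\psi:\mathbb{R}^m\to\mathbb{R}\cup\{\infty\}$, $\varphi:\mathbb{R}^n\to\mathbb{R}\cup\{\infty\}$ be proper lower semicontinuous. Put $f(x)=\psi(Ax-b)$, $F=f+\varphi$. Standing assumptions: (i) there is a closed set $\Omega\subseteq\mathbb{R}^n$ with $\operatorname{dom}\varphi\subseteq\Omega$ such that $\psi$ is twice continuously differentiable on an open set containing $\{Ax-b: x\in\Omega\}$; (ii) $\varphi$ is convex and continuous on (relative to) $\operatorname{dom}\varphi$; (iii) $\inf F>-\infty$. Thus $\nabla f(x)=A^\top\nabla\psi(Ax-b)$, $\nabla^2f(x)=A^\top\nabla^2\psi(Ax-b)A$ for $x\in\Omega$. $\|\cdot\|$ is the Euclidean norm for vectors and the spectral norm for matrices, $\lambda_{\min}$ is the smallest eigenvalue, $t_+=\max(0,t)$, $B_\varepsilon(x)$ is the closed Euclidean ball, $\operatorname{dist}$ is Euclidean distance, $\operatorname{prox}_\varphi(x)=\operatorname{argmin}_y\{\varphi(y)+\frac12\|y-x\|^2\}$. The residual is $r(x)=x-\operatorname{prox}_\varphi(x-\nabla f(x))$; $x\in\operatorname{dom}\varphi$ is stationary, i.e. $0\in\nabla f(x)+\partial\varphi(x)$, iff $r(x)=0$. A stationary point $x$ is strongly stationary if in addition $\nabla^2\psi(Ax-b)\succeq0$; $X^*$ is the set of strongly stationary points. Algorithm (regularized proximal Newton method). Choose $x^0\in\operatorname{dom}\varphi$, $0<c_1<c_2<1$,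 $\sigma_1\in(0,1)$, $\sigma_2>1$, $\eta,\theta,\alpha\in(0,1)$, $a\ge1$, $0<\nu_{\min}\le\nu_0\le\overline\nu$, $0<\delta\le1$, $\tau\ge\delta$, $p_{\min}\in(0,1/2)$, $\kappa>1+\delta$. Set $\overline r_0=\|r(x^0)\|$, $\mu_0=\nu_0\overline r_0^{\,\delta}$. For $k=0,1,2,\dots$: Let $\Lambda_k=a[-\lambda_{\min}(\nabla^2\psi(Ax^k-b))]_+$, $H_k=\nabla^2f(x^k)+\Lambda_kA^\top A$ (positive semidefinite), $G_k=H_k+\mu_kI$, $q_k(x)=f(x^k)+\nabla f(x^k)^\top(x-x^k)+\frac12(x-x^k)^\top\nabla^2f(x^k)(x-x^k)+\varphi(x)$, $\hat q_k(x)=f(x^k)+\nabla f(x^k)^\top(x-x^k)+\frac12(x-x^k)^\top G_k(x-x^k)+\varphi(x)$, $R_k(x)=x-\operatorname{prox}_\varphi(x-\nabla f(x^k)-G_k(x-x^k))$. Step 1: compute an inexact minimizer $\hat x^k$ of $\hat q_k$, i.e. any point with $\|R_k(\hat x^k)\|\le\theta\min\{\|r(x^k)\|,\|r(x^k)\|^{1+\tau}\}$ and $F(x^k)-\hat q_k(\hat x^k)\ge\frac{\alpha\mu_k}{2}\|\hat x^k-x^k\|^2$. Step 2: set $d^k=\hat x^k-x^k$, $\mathrm{pred}_k=F(x^k)-q_k(\hat x^k)$, $\mathrm{ared}_k=F(x^k)-F(\hat x^k)$, $\rho_k=\mathrm{ared}_k/\mathrm{pred}_k$. Step 3: if $\mathrm{pred}_k\le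 p_{\min}(1-\theta)\|d^k\|\min\{\|r(x^k)\|,\|r(x^k)\|^\kappa\}$ or $\rho_k\le c_1$, set $x^{k+1}=x^k$, $\nu_{k+1}=\sigma_2\nu_k$ (unsuccessful iteration). Otherwise set $x^{k+1}=\hat x^k$ and: if $\rho_k\le c_2$, $\nu_{k+1}=\min\{\nu_k,\overline\nu\}$ (successful iteration); if $\rho_k>c_2$, $\nu_{k+1}=\min\{\max\{\sigma_1\nu_k,\nu_{\min}\},\overline\nu\}$ (highly successful iteration). Step 4: if $\|r(x^{k+1})\|\le\eta\overline r_k$, set $\overline r_{k+1}=\|r(x^{k+1})\|$; otherwise $\overline r_{k+1}=\overline r_k$. Set $\mu_{k+1}=\nu_{k+1}\overline r_{k+1}^{\,\delta}$. $\mathcal K=\{0\}\cup\{k\in\mathbb{N}:\ \|r(x^k)\|\le\eta\overline r_{k-1}\}$ (the indices $k$ for which the if-condition of Step 4 held in iteration $k-1$); this set is infinite. A nonnegative sequence $\{t_k\}$ converges to $0$ at the rate of $s>1$ if $t_k\to0$ and there is $C>0$ with $t_{k+1}\le Ct_k^{s}$ for all sufficiently large $k$. *)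

theory Defs
  imports "HOL-Analysis.Analysis"
begin

definition edom :: "('a \<Rightarrow> ereal) \<Rightarrow> 'a set" where
  "edom g = {x. g x < \<infinity>}"

definition proper :: "('a \<Rightarrow> ereal) \<Rightarrow> bool" where
  "proper g \<longleftrightarrow> (\<forall>x. g x \<noteq> - \<infinity>) \<and> edom g \<noteq> {}"

definition lsc :: "('a::topological_space \<Rightarrow> ereal) \<Rightarrow> bool" where
  "lsc g \<longleftrightarrow> (\<forall>x. g x \<le> Liminf (at x) g)"

definition econvex :: "('a::real_vector \<Rightarrow> ereal) \<Rightarrow> bool" where
  "econvex g \<longleftrightarrow> convex_on (edom g) (\<lambda>x. real_of_ereal (g x))"

definition subdifferential :: "('a::real_inner \<Rightarrow> ereal) \<Rightarrow> 'a \<Rightarrow> 'a set" where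
  "subdifferential g x = {v. \<forall>y. g x + ereal (v \<bullet> (y - x)) \<le> g y}"

text \<open>For proper, lower semicontinuous, convex \<open>g\<close> the minimizer exists and is unique.\<close>

definition prox :: "('a::real_inner \<Rightarrow> ereal) \<Rightarrow> 'a \<Rightarrow> 'a" where
  "prox g x = (ARG_MIN (\<lambda>y. g y + ereal ((norm (y - x))\<^sup>2 / 2)) y. True)"

definition grad :: "('a::real_inner \<Rightarrow> real) \<Rightarrow> 'a \<Rightarrow> 'a" where
  "grad g x = (THE D. GDERIV g x :> D)"

definition hess :: "(real^'n \<Rightarrow> real) \<Rightarrow> real^'n \<Rightarrow> real^'n^'n" where
  "hess g x = jacobian (grad g) (at x)"

definition C2_on :: "(real^'n) set \<Rightarrow> (real^'n \<Rightarrow> real) \<Rightarrow> bool" where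
  "C2_on U g \<longleftrightarrow> (\<forall>x\<in>U. g differentiable (at x)) \<and>
     (\<forall>x\<in>U. grad g differentiable (at x)) \<and> continuous_on U (hess g)"

definition eigenvalue :: "real^'n^'n \<Rightarrow> real \<Rightarrow> bool" where
  "eigenvalue M l \<longleftrightarrow> (\<exists>v. v \<noteq> 0 \<and> M *v v = l *\<^sub>R v)"

definition lambda_min :: "real^'n^'n \<Rightarrow> real" where
  "lambda_min M = (LEAST l. eigenvalue M l)"

text \<open>Only applied to Hessians of twice continuously differentiable functions, which are
  symmetric; symmetry is therefore not part of the definition.\<close>

definition psd :: "real^'n^'n \<Rightarrow> bool" where
  "psd M \<longleftrightarrow> (\<forall>v. 0 \<le> v \<bullet> (M *v v))"

definition spectral_norm :: "real^'n^'m \<Rightarrow> real" where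
  "spectral_norm M = onorm ((*v) M)"

definition accumulation_point_along :: "(nat \<Rightarrow> 'a::topological_space) \<Rightarrow> nat set \<Rightarrow> 'a \<Rightarrow> bool" where
  "accumulation_point_along x K l \<longleftrightarrow>
     (\<exists>s. strict_mono s \<and> range s \<subseteq> K \<and> (x \<circ> s) \<longlonglongrightarrow> l)"

definition converges_to_0_at_rate :: "(nat \<Rightarrow> real) \<Rightarrow> real \<Rightarrow> bool" where
  "converges_to_0_at_rate t s \<longleftrightarrow>
     t \<longlonglongrightarrow> 0 \<and> (\<exists>C>0. \<forall>\<^sub>F k in sequentially. t (Suc k) \<le> C * t k powr s)"

locale composite_data =
  fixes A :: "real^'n^'m" and b :: "real^'m"
    and \<psi> :: "real^'m \<Rightarrow> ereal" and \<phi> :: "real^'n \<Rightarrow> ereal"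
begin

definition f :: "real^'n \<Rightarrow> ereal" where
  "f x = \<psi> (A *v x - b)"

definition F :: "real^'n \<Rightarrow> ereal" where
  "F x = f x + \<phi> x"

text \<open>The derivatives below are meaningful only near points where the function is finite; they are
  evaluated at points of the domain of \<open>\<phi>\<close> (for \<open>f\<close>) or at their images under
  \<open>x \<mapsto> A x - b\<close> (for \<open>\<psi>\<close>).\<close>

definition grad_f :: "real^'n \<Rightarrow> real^'n" where
  "grad_f = grad (\<lambda>x. real_of_ereal (f x))"

definition hess_f :: "real^'n \<Rightarrow> real^'n^'n" where
  "hess_f = hess (\<lambda>x. real_of_ereal (f x))"

definition hess_psi :: "real^'m \<Rightarrow> real^'m^'m" where
  "hess_psi = hess (\<lambda>y. real_of_ereal (\<psi> y))"

definition residual :: "real^'n \<Rightarrow> real^'n" where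
  "residual x = x - prox \<phi> (x - grad_f x)"

definition stationary :: "real^'n \<Rightarrow> bool" where
  "stationary x \<longleftrightarrow> x \<in> edom \<phi> \<and> 0 \<in> (\<lambda>v. grad_f x + v) ` subdifferential \<phi> x"

definition strongly_stationary_points :: "(real^'n) set" where
  "strongly_stationary_points = {x. stationary x \<and> psd (hess_psi (A *v x - b))}"

end

locale composite_problem = composite_data A b \<psi> \<phi>
  for A :: "real^'n^'m" and b :: "real^'m"
    and \<psi> :: "real^'m \<Rightarrow> ereal" and \<phi> :: "real^'n \<Rightarrow> ereal" +
  assumes psi_proper: "proper \<psi>" and psi_lsc: "lsc \<psi>"
    and phi_proper: "proper \<phi>" and phi_lsc: "lsc \<phi>"
    and smooth: "\<exists>\<Omega> U. closed \<Omega> \<and> edom \<phi> \<subseteq> \<Omega> \<and> open U \<and> (\<lambda>x. A *v x - b) ` \<Omega> \<subseteq> U \<and>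
       (\<forall>y\<in>U. \<psi> y < \<infinity>) \<and> C2_on U (\<lambda>y. real_of_ereal (\<psi> y))"
    and phi_convex: "econvex \<phi>"
    and phi_continuous: "continuous_on (edom \<phi>) \<phi>"
    and F_bounded_below: "(INF x. F x) > - \<infinity>"

locale newton_data = composite_data A b \<psi> \<phi>
  for A :: "real^'n^'m" and b :: "real^'m"
    and \<psi> :: "real^'m \<Rightarrow> ereal" and \<phi> :: "real^'n \<Rightarrow> ereal" +
  fixes c\<^sub>1 c\<^sub>2 \<sigma>\<^sub>1 \<sigma>\<^sub>2 \<eta> \<theta> \<alpha> a \<nu>_min \<nu>_bar \<delta> \<tau> p_min \<kappa> :: real
    and x xhat :: "nat \<Rightarrow> real^'n" and \<nu> rbar :: "nat \<Rightarrow> real"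
begin

definition \<mu> :: "nat \<Rightarrow> real" where
  "\<mu> k = \<nu> k * rbar k powr \<delta>"

definition \<Lambda> :: "nat \<Rightarrow> real" where
  "\<Lambda> k = a * max 0 (- lambda_min (hess_psi (A *v x k - b)))"

definition H :: "nat \<Rightarrow> real^'n^'n" where
  "H k = hess_f (x k) + \<Lambda> k *\<^sub>R (transpose A ** A)"

definition G :: "nat \<Rightarrow> real^'n^'n" where
  "G k = H k + \<mu> k *\<^sub>R mat 1"

definition q :: "nat \<Rightarrow> real^'n \<Rightarrow> ereal" where
  "q k y = f (x k)
     + ereal (grad_f (x k) \<bullet> (y - x k) + (1/2) * ((y - x k) \<bullet> (hess_f (x k) *v (y - x k))))
     + \<phi> y"

definition qhat :: "nat \<Rightarrow> real^'n \<Rightarrow> ereal" where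
  "qhat k y = f (x k)
     + ereal (grad_f (x k) \<bullet> (y - x k) + (1/2) * ((y - x k) \<bullet> (G k *v (y - x k))))
     + \<phi> y"

definition R :: "nat \<Rightarrow> real^'n \<Rightarrow> real^'n" where
  "R k y = y - prox \<phi> (y - grad_f (x k) - G k *v (y - x k))"

definition d :: "nat \<Rightarrow> real^'n" where
  "d k = xhat k - x k"

text \<open>In a run of the method all the values entering \<open>pred\<close> and \<open>ared\<close> are finite: the second
  requirement on the inexact minimizer, an inequality in the extended reals, forces
  \<open>xhat k\<close> into the domain of \<open>\<phi>\<close>. So \<^const>\<open>real_of_ereal\<close> loses nothing there.\<close>

definition pred :: "nat \<Rightarrow> real" where
  "pred k = real_of_ereal (F (x k) - q k (xhat k))"

definition ared :: "nat \<Rightarrow> real" where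
  "ared k = real_of_ereal (F (x k) - F (xhat k))"

definition \<rho> :: "nat \<Rightarrow> real" where
  "\<rho> k = ared k / pred k"

definition inexact_minimizer :: "nat \<Rightarrow> bool" where
  "inexact_minimizer k \<longleftrightarrow>
     norm (R k (xhat k))
       \<le> \<theta> * min (norm (residual (x k))) (norm (residual (x k)) powr (1 + \<tau>)) \<and>
     F (x k) - qhat k (xhat k) \<ge> ereal (\<alpha> * \<mu> k / 2 * (norm (xhat k - x k))\<^sup>2)"

definition unsuccessful :: "nat \<Rightarrow> bool" where
  "unsuccessful k \<longleftrightarrow>
     pred k \<le> p_min * (1 - \<theta>) * norm (d k)
                * min (norm (residual (x k))) (norm (residual (x k)) powr \<kappa>)
     \<or> \<rho> k \<le> c\<^sub>1"

definition K :: "nat set" where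
  "K = {0} \<union> {k. k \<ge> 1 \<and> norm (residual (x k)) \<le> \<eta> * rbar (k - 1)}"

end

text \<open>The iterates form an infinite run of the method applied to an instance of the problem class.\<close>

locale reg_prox_newton =
  composite_problem A b \<psi> \<phi> +
  newton_data A b \<psi> \<phi> c\<^sub>1 c\<^sub>2 \<sigma>\<^sub>1 \<sigma>\<^sub>2 \<eta> \<theta> \<alpha> a \<nu>_min \<nu>_bar \<delta> \<tau> p_min \<kappa> x xhat \<nu> rbar
  for A :: "real^'n^'m" and b :: "real^'m"
    and \<psi> :: "real^'m \<Rightarrow> ereal" and \<phi> :: "real^'n \<Rightarrow> ereal"
    and c\<^sub>1 c\<^sub>2 \<sigma>\<^sub>1 \<sigma>\<^sub>2 \<eta> \<theta> \<alpha> a \<nu>_min \<nu>_bar \<delta> \<tau> p_min \<kappa> :: real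
    and x xhat :: "nat \<Rightarrow> real^'n" and \<nu> rbar :: "nat \<Rightarrow> real" +
  assumes c: "0 < c\<^sub>1" "c\<^sub>1 < c\<^sub>2" "c\<^sub>2 < 1"
    and sigma1: "0 < \<sigma>\<^sub>1" "\<sigma>\<^sub>1 < 1" and sigma2: "1 < \<sigma>\<^sub>2"
    and eta: "0 < \<eta>" "\<eta> < 1" and theta: "0 < \<theta>" "\<theta> < 1" and alpha: "0 < \<alpha>" "\<alpha> < 1"
    and a: "1 \<le> a"
    and nu: "0 < \<nu>_min" "\<nu>_min \<le> \<nu> 0" "\<nu> 0 \<le> \<nu>_bar"
    and delta: "0 < \<delta>" "\<delta> \<le> 1" and tau: "\<delta> \<le> \<tau>"
    and p_min: "0 < p_min" "p_min < 1/2" and kappa: "1 + \<delta> < \<kappa>"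
    and x_0: "x 0 \<in> edom \<phi>"
    and rbar_0: "rbar 0 = norm (residual (x 0))"
    and xhat: "inexact_minimizer k"
    and x_Suc: "x (Suc k) = (if unsuccessful k then x k else xhat k)"
    and nu_Suc: "\<nu> (Suc k) =
       (if unsuccessful k then \<sigma>\<^sub>2 * \<nu> k
        else if \<rho> k \<le> c\<^sub>2 then min (\<nu> k) \<nu>_bar
        else min (max (\<sigma>\<^sub>1 * \<nu> k) \<nu>_min) \<nu>_bar)"
    and rbar_Suc: "rbar (Suc k) =
       (if norm (residual (x (Suc k))) \<le> \<eta> * rbar k then norm (residual (x (Suc k))) else rbar k)"

end

theory Submission
  imports Defs
begin


text \<open>
  At an index \<open>k\<close> of \<open>K\<close> the regularization is \<open>\<mu> k = \<nu> k * r powr \<delta>\<close> with \<open>r = norm (residual (x k))\<close>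
  and \<open>\<nu> k\<close> between two positive constants. Let \<open>x k\<close> be close to \<open>xstar\<close> and \<open>z\<close> a strongly
  stationary point at distance \<open>t\<close> comparable to \<open>infdist (x k) X\<close>. Since the Hessian of \<open>\<psi>\<close> is positive
  semidefinite at \<open>z\<close>, the convexification \<open>\<Lambda> k\<close> is \<open>O(t)\<close>; monotonicity of the subdifferential of \<open>\<phi>\<close>
  gives \<open>\<mu> k * norm (d k) \<le> O(t\<^sup>2 + \<mu> k * t + r powr (1 + \<tau>))\<close>, and the error bound with \<open>p > \<delta>\<close>
  turns this into \<open>norm (d k) = O(t)\<close>. Hence the model error \<open>O(norm (d k) ^ 3)\<close> is small compared with the
  predicted decrease \<open>\<mu> k / 2 * (norm (d k))\<^sup>2\<close>, the step is accepted, and the new residual is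
  \<open>O(r powr (1 + \<tau>) + r powr \<delta> * t)\<close>, which is superlinearly small. So \<open>Suc k\<close> lies in \<open>K\<close> again, and
  as the distances to \<open>X\<close> are at least halved, the steps sum up and the iterates stay near \<open>xstar\<close>.
\<close>

section \<open>Gradients, Hessians and the smallest eigenvalue\<close>

lemma grad_eqI:
  assumes "GDERIV g x :> D"
  shows "grad g x = D"
  unfolding grad_def
proof (rule the_equality)
  show "GDERIV g x :> D" by (rule assms)
next
  fix E assume "GDERIV g x :> E"
  with assms have "(\<lambda>h. h \<bullet> E) = (\<lambda>h. h \<bullet> D)"
    unfolding gderiv_def by (rule has_derivative_unique[symmetric])
  then show "E = D" by (metis vector_eq_ldot)
qed

text \<open>A linear functional on a Euclidean space is the inner product with the vector of its
  values on the basis; this vector is what the description in \<open>grad\<close> denotes.\<close>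

lemma grad_has_derivative:
  fixes g :: "'a::euclidean_space \<Rightarrow> real"
  assumes "g differentiable (at x)"
  shows "(g has_derivative (\<lambda>h. h \<bullet> grad g x)) (at x)"
proof -
  obtain g' where g': "(g has_derivative g') (at x)"
    using assms by (auto simp: differentiable_def)
  then interpret linear g' by (rule has_derivative_linear)
  have "g' h = h \<bullet> (\<Sum>i\<in>Basis. g' i *\<^sub>R i)" for h
  proof -
    have "g' h = g' (\<Sum>i\<in>Basis. (h \<bullet> i) *\<^sub>R i)" by (simp add: euclidean_representation)
    also have "\<dots> = (\<Sum>i\<in>Basis. (h \<bullet> i) * g' i)" by (simp add: sum scaleR)
    finally show ?thesis by (simp add: inner_sum_right mult.commute)
  qed
  then have "g' = (\<lambda>h. h \<bullet> (\<Sum>i\<in>Basis. g' i *\<^sub>R i))" by blast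
  then have D: "GDERIV g x :> (\<Sum>i\<in>Basis. g' i *\<^sub>R i)" using g' by (simp add: gderiv_def)
  show ?thesis using D unfolding grad_eqI[OF D] gderiv_def .
qed

lemma hess_has_derivative:
  assumes "grad g differentiable (at x)"
  shows "(grad g has_derivative (\<lambda>h. hess g x *v h)) (at x)"
  using assms unfolding hess_def by (simp flip: jacobian_works)

text \<open>Both mixed derivatives are limits of the same second difference quotient.\<close>

lemma second_difference_approx:
  fixes g :: "'a::euclidean_space \<Rightarrow> real"
  assumes U: "open U" "y \<in> U" and g: "\<And>x. x \<in> U \<Longrightarrow> g differentiable (at x)"
    and H: "(grad g has_derivative H) (at y)" and e: "0 < e"
  shows "\<exists>s0>0. \<forall>s. 0 < s \<and> s < s0 \<longrightarrow>
     \<bar>g (y + s *\<^sub>R u + s *\<^sub>R v) - g (y + s *\<^sub>R u) - g (y + s *\<^sub>R v) + g y - s\<^sup>2 * (u \<bullet> H v)\<bar>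
       \<le> e * s\<^sup>2"
proof -
  interpret H: linear H using H by (rule has_derivative_linear)
  define N where "N = norm u + norm v + 1"
  have N: "N \<ge> 1" "norm u \<le> N" "norm v \<le> N" by (auto simp: N_def)
  \<comment> \<open>Two linearization errors of the gradient, each at most
    \<open>e' * (s * N)\<close>, will be multiplied by \<open>s * N\<close>; with this
    \<open>e'\<close> the total is exactly \<open>e * s\<^sup>2\<close>.\<close>
  define e' where "e' = e / (2 * N * N)"
  have e': "e' > 0" using e N by (auto simp: e'_def)
  obtain r where r: "r > 0" "ball y r \<subseteq> U" using U openE by blast
  from H e' obtain w where w: "w > 0"
    "\<And>z. norm (z - y) < w \<Longrightarrow> norm (grad g z - grad g y - H (z - y)) \<le> e' * norm (z - y)"
    unfolding has_derivative_at_alt by meson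
  define s0 where "s0 = min r w / N"
  have s0: "s0 > 0" using r w N by (auto simp: s0_def)
  show ?thesis
  proof (intro exI[of _ s0] conjI s0 allI impI)
    fix s :: real assume s: "0 < s \<and> s < s0"
    then have sN: "s * N < r" "s * N < w"
      using N by (auto simp: s0_def pos_less_divide_eq)
    have small: "norm (t *\<^sub>R (s *\<^sub>R u) + c *\<^sub>R (s *\<^sub>R v)) \<le> s * N" if "0 \<le> t" "t \<le> 1" "0 \<le> c" "c \<le> 1" for t c
    proof -
      have "norm (t *\<^sub>R (s *\<^sub>R u) + c *\<^sub>R (s *\<^sub>R v)) \<le> t * (s * norm u) + c * (s * norm v)"
        using that s norm_triangle_ineq[of "t *\<^sub>R (s *\<^sub>R u)" "c *\<^sub>R (s *\<^sub>R v)"] by simp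
      also have "\<dots> \<le> 1 * (s * norm u) + 1 * (s * norm v)"
        using that s by (intro add_mono mult_right_mono) auto
      also have "\<dots> \<le> s * N" using s by (simp add: N_def algebra_simps)
      finally show ?thesis .
    qed
    let ?p = "\<lambda>t c. y + t *\<^sub>R (s *\<^sub>R u) + c *\<^sub>R (s *\<^sub>R v)"
    have inU: "?p t c \<in> U" if "0 \<le> t" "t \<le> 1" "0 \<le> c" "c \<le> 1" for t c
    proof -
      have "dist y (?p t c) = norm (t *\<^sub>R (s *\<^sub>R u) + c *\<^sub>R (s *\<^sub>R v))"
        unfolding dist_commute[of y] by (simp add: dist_norm add.assoc del: scaleR_scaleR)
      then have "dist y (?p t c) < r" using small[OF that] sN by linarith
      then show ?thesis using r by auto
    qed
    \<comment> \<open>\<open>h 1 - h 0\<close> is the second difference. The mean value theorem in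
      the direction \<open>u\<close> turns it into a difference of gradients in the direction
      \<open>v\<close>, which the derivative \<open>H\<close> at \<open>y\<close>
      approximates.\<close>
    define h where "h t = g (?p t 1) - g (?p t 0)" for t
    have dp: "((\<lambda>t. ?p t c) has_derivative (\<lambda>\<xi>. \<xi> *\<^sub>R (s *\<^sub>R u))) (at t)" for t c
      by (auto intro!: derivative_eq_intros)
    have dh: "(h has_derivative (\<lambda>\<xi>. \<xi> * (s * (u \<bullet> (grad g (?p t 1) - grad g (?p t 0)))))) (at t)"
      if t: "0 \<le> t" "t \<le> 1" for t
    proof -
      have *: "((\<lambda>t. g (?p t c)) has_derivative (\<lambda>\<xi>. (\<xi> *\<^sub>R (s *\<^sub>R u)) \<bullet> grad g (?p t c))) (at t)"
        if "0 \<le> c" "c \<le> 1" for c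
        using has_derivative_compose[OF dp grad_has_derivative[OF g[OF inU[OF t that]]]] .
      have "(h has_derivative (\<lambda>\<xi>. (\<xi> *\<^sub>R (s *\<^sub>R u)) \<bullet> grad g (?p t 1) - (\<xi> *\<^sub>R (s *\<^sub>R u)) \<bullet> grad g (?p t 0))) (at t)"
        unfolding h_def by (rule has_derivative_diff[OF *[of 1] *[of 0]]) auto
      then show ?thesis by (simp add: algebra_simps inner_diff_right)
    qed
    have "\<exists>t\<in>{0<..<1}. h 1 - h 0 = (1 - 0) * (s * (u \<bullet> (grad g (?p t 1) - grad g (?p t 0))))"
      by (rule mvt_simple) (simp, rule has_derivative_at_withinI[OF dh])
    then obtain t where t: "0 < t" "t < 1"
      and hm: "h 1 - h 0 = s * (u \<bullet> (grad g (?p t 1) - grad g (?p t 0)))" by auto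
    let ?E = "\<lambda>c. grad g (?p t c) - grad g y - H (?p t c - y)"
    have E: "norm (?E c) \<le> e' * (s * N)" if "0 \<le> c" "c \<le> 1" for c
    proof -
      have n: "norm (?p t c - y) \<le> s * N" using small[of t c] t that by (simp add: algebra_simps)
      then have "norm (?E c) \<le> e' * norm (?p t c - y)" using sN by (intro w) auto
      also have "\<dots> \<le> e' * (s * N)" using n e' by (intro mult_left_mono) auto
      finally show ?thesis .
    qed
    have "grad g (?p t 1) - grad g (?p t 0) = s *\<^sub>R H v + (?E 1 - ?E 0)"
      by (simp add: H.add H.scale algebra_simps)
    then have "h 1 - h 0 - s\<^sup>2 * (u \<bullet> H v) = s * (u \<bullet> (?E 1 - ?E 0))"
      unfolding hm by (simp add: inner_add_right power2_eq_square algebra_simps)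
    then have "\<bar>h 1 - h 0 - s\<^sup>2 * (u \<bullet> H v)\<bar> = s * \<bar>u \<bullet> (?E 1 - ?E 0)\<bar>"
      using s by (simp add: abs_mult)
    also have "\<dots> \<le> s * (N * (e' * (s * N) + e' * (s * N)))"
    proof -
      have "\<bar>u \<bullet> (?E 1 - ?E 0)\<bar> \<le> norm u * norm (?E 1 - ?E 0)" by (rule Cauchy_Schwarz_ineq2)
      also have "\<dots> \<le> N * (e' * (s * N) + e' * (s * N))"
        using N by (intro mult_mono order_trans[OF norm_triangle_ineq4 add_mono[OF E E]]) auto
      finally show ?thesis using s by (intro mult_left_mono) auto
    qed
    also have "\<dots> = e * s\<^sup>2" using N by (simp add: e'_def power2_eq_square field_simps)
    finally show "\<bar>g (y + s *\<^sub>R u + s *\<^sub>R v) - g (y + s *\<^sub>R u) - g (y + s *\<^sub>R v) + g y - s\<^sup>2 * (u \<bullet> H v)\<bar>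
       \<le> e * s\<^sup>2" by (simp add: h_def algebra_simps)
  qed
qed

lemma second_derivative_symmetric:
  fixes g :: "'a::euclidean_space \<Rightarrow> real"
  assumes U: "open U" "y \<in> U" "\<And>x. x \<in> U \<Longrightarrow> g differentiable (at x)"
    and H: "(grad g has_derivative H) (at y)"
  shows "u \<bullet> H v = v \<bullet> H u"
proof (rule ccontr)
  assume ne: "u \<bullet> H v \<noteq> v \<bullet> H u"
  \<comment> \<open>A third of the gap: both forms, scaled by \<open>s\<^sup>2\<close>, lie within
    \<open>e * s\<^sup>2\<close> of the same second difference, so the gap would be at most
    \<open>2 * e\<close>.\<close>
  define e where "e = \<bar>u \<bullet> H v - v \<bullet> H u\<bar> / 3"
  have e: "e > 0" using ne by (simp add: e_def)
  obtain s1 where s1: "s1 > 0" "\<And>s. 0 < s \<Longrightarrow> s < s1 \<Longrightarrow>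
     \<bar>g (y + s *\<^sub>R u + s *\<^sub>R v) - g (y + s *\<^sub>R u) - g (y + s *\<^sub>R v) + g y - s\<^sup>2 * (u \<bullet> H v)\<bar> \<le> e * s\<^sup>2"
    using second_difference_approx[OF U H e] by blast
  obtain s2 where s2: "s2 > 0" "\<And>s. 0 < s \<Longrightarrow> s < s2 \<Longrightarrow>
     \<bar>g (y + s *\<^sub>R v + s *\<^sub>R u) - g (y + s *\<^sub>R v) - g (y + s *\<^sub>R u) + g y - s\<^sup>2 * (v \<bullet> H u)\<bar> \<le> e * s\<^sup>2"
    using second_difference_approx[OF U H e] by blast
  define s where "s = min s1 s2 / 2"
  have s: "0 < s" "s < s1" "s < s2" using s1(1) s2(1) by (auto simp: s_def)
  have "y + s *\<^sub>R v + s *\<^sub>R u = y + s *\<^sub>R u + s *\<^sub>R v" by simp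
  with s1(2)[of s] s2(2)[of s] s have "\<bar>s\<^sup>2 * (u \<bullet> H v) - s\<^sup>2 * (v \<bullet> H u)\<bar> \<le> 2 * e * s\<^sup>2"
    by (simp add: add.commute add.left_commute)
  then have "s\<^sup>2 * \<bar>u \<bullet> H v - v \<bullet> H u\<bar> \<le> s\<^sup>2 * (2 * e)"
    by (simp only: abs_mult flip: right_diff_distrib) (simp add: algebra_simps)
  then have "\<bar>u \<bullet> H v - v \<bullet> H u\<bar> \<le> 2 * e" using s by simp
  then show False using e by (simp add: e_def)
qed

text \<open>A parabola through the origin that is nowhere negative has a minimum there, so its slope
  at the origin vanishes.\<close>

lemma linear_term_eq_0:
  fixes b c :: real
  assumes "\<And>t. 0 \<le> 2 * t * b + t\<^sup>2 * c"
  shows "b = 0"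
proof (rule ccontr)
  assume b: "b \<noteq> 0"
  have c: "c \<ge> 0" using assms[of 1] assms[of "-1"] by auto
  \<comment> \<open>The parabola is tested near its vertex \<open>- b / c\<close>; the denominator
    \<open>c + 1\<close> also covers \<open>c = 0\<close>.\<close>
  have "2 * (- b / (c + 1)) * b + (- b / (c + 1))\<^sup>2 * c = - (b\<^sup>2 * (c + 2) / (c + 1)\<^sup>2)"
    using c by (simp add: divide_simps power2_eq_square) (simp add: algebra_simps)
  moreover have "b\<^sup>2 * (c + 2) / (c + 1)\<^sup>2 > 0" using b c by (intro divide_pos_pos mult_pos_pos) auto
  ultimately show False using assms[of "- b / (c + 1)"] by linarith
qed

text \<open>The minimum of the Rayleigh quotient over the unit sphere is attained at an eigenvector.\<close>

lemma lambda_min_rayleigh: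
  fixes M :: "real^'n^'n"
  assumes sym: "\<And>u v. u \<bullet> (M *v v) = v \<bullet> (M *v u)"
  shows lambda_min_attained: "\<exists>v. norm v = 1 \<and> v \<bullet> (M *v v) = lambda_min M"
    and lambda_min_le: "\<And>v. lambda_min M * (v \<bullet> v) \<le> v \<bullet> (M *v v)"
proof -
  let ?S = "sphere (0::real^'n) 1"
  have "?S \<noteq> {}" by simp
  moreover have "continuous_on ?S (\<lambda>v. v \<bullet> (M *v v))"
    by (intro continuous_intros linear_continuous_on linear_linear[THEN iffD2] matrix_vector_mul_linear)
  ultimately obtain v0 where v0: "norm v0 = 1" and min: "\<And>v. norm v = 1 \<Longrightarrow> v0 \<bullet> (M *v v0) \<le> v \<bullet> (M *v v)"
    using continuous_attains_inf[of ?S "\<lambda>v. v \<bullet> (M *v v)"] by auto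
  define l where "l = v0 \<bullet> (M *v v0)"
  have ge: "l * (v \<bullet> v) \<le> v \<bullet> (M *v v)" for v
  proof (cases "v = 0")
    case False
    have "l \<le> (v /\<^sub>R norm v) \<bullet> (M *v (v /\<^sub>R norm v))"
      unfolding l_def using False by (intro min) simp
    also have "\<dots> = (v \<bullet> (M *v v)) / (v \<bullet> v)"
      by (simp add: matrix_vector_mult_scaleR dot_square_norm power2_eq_square field_simps)
    finally show ?thesis using False by (simp add: field_simps)
  qed auto
  let ?w = "M *v v0 - l *\<^sub>R v0"
  have vv: "v0 \<bullet> v0 = 1" using v0 by (simp add: dot_square_norm)
  \<comment> \<open>First-order optimality of \<open>v0\<close>, tested in the direction of the
    eigenvector defect \<open>?w\<close> itself: the linear coefficient is then
    \<open>2 * (?w \<bullet> ?w)\<close>.\<close>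
  have "?w \<bullet> ?w = 0"
  proof (rule linear_term_eq_0)
    fix t :: real
    have "0 \<le> (v0 + t *\<^sub>R ?w) \<bullet> (M *v (v0 + t *\<^sub>R ?w)) - l * ((v0 + t *\<^sub>R ?w) \<bullet> (v0 + t *\<^sub>R ?w))"
      using ge by simp
    also have "\<dots> = 2 * t * (?w \<bullet> ?w) + t\<^sup>2 * (?w \<bullet> (M *v ?w) - l * (?w \<bullet> ?w))"
    proof -
      have gen: "(v0 + t *\<^sub>R w) \<bullet> (M *v (v0 + t *\<^sub>R w)) - l * ((v0 + t *\<^sub>R w) \<bullet> (v0 + t *\<^sub>R w))
        = 2 * t * (w \<bullet> (M *v v0) - l * (w \<bullet> v0)) + t\<^sup>2 * (w \<bullet> (M *v w) - l * (w \<bullet> w))" for w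
        using sym[of v0 w] vv
        by (simp add: matrix_vector_right_distrib matrix_vector_mult_scaleR inner_add_left inner_add_right
            l_def[symmetric] inner_commute[of v0 w] power2_eq_square algebra_simps)
      show ?thesis unfolding gen by (simp add: inner_diff_right)
    qed
    finally show "0 \<le> 2 * t * (?w \<bullet> ?w) + t\<^sup>2 * (?w \<bullet> (M *v ?w) - l * (?w \<bullet> ?w))" .
  qed
  then have "M *v v0 = l *\<^sub>R v0" by simp
  then have ev: "eigenvalue M l" unfolding eigenvalue_def using v0 by (intro exI[of _ v0]) auto
  \<comment> \<open>An eigenvector for \<open>l'\<close> has Rayleigh quotient \<open>l'\<close>, so
    \<open>l\<close> is the least eigenvalue and \<open>LEAST\<close> really picks it.\<close>
  have "l \<le> l'" if "eigenvalue M l'" for l'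
  proof -
    from that obtain v where v: "v \<noteq> 0" "M *v v = l' *\<^sub>R v" unfolding eigenvalue_def by blast
    then show ?thesis using ge[of v] by simp
  qed
  with ev have l: "lambda_min M = l" unfolding lambda_min_def by (intro Least_equality)
  show "\<exists>v. norm v = 1 \<and> v \<bullet> (M *v v) = lambda_min M" using v0 l by (auto simp: l_def)
  show "\<And>v. lambda_min M * (v \<bullet> v) \<le> v \<bullet> (M *v v)" using ge l by simp
qed

lemma norm_spectral_norm: "norm (M *v v) \<le> spectral_norm M * norm v"
  unfolding spectral_norm_def by (intro onorm linear_linear[THEN iffD1] matrix_vector_mul_bounded_linear)


section \<open>Proximal operators\<close>

lemma lsc_eventually_less:
  assumes "lsc g" "c < g x"
  shows "\<forall>\<^sub>F y in nhds x. c < g y"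
proof -
  have "c < Liminf (at x) g" using assms unfolding lsc_def by (meson less_le_trans)
  then have "\<forall>\<^sub>F y in at x. c < g y" by (rule less_LiminfD)
  then show ?thesis using assms(2) by (auto simp: eventually_at_filter elim!: eventually_mono)
qed

text \<open>Without a minimizer, every point of \<open>C\<close> has a neighbourhood on which
  \<open>g\<close> exceeds its value at some other point of \<open>C\<close>. Of the finitely many
  such points belonging to a finite subcover the lowest lies in one of the neighbourhoods, and so is
  not the lowest.\<close>

lemma lsc_attains_inf:
  assumes g: "lsc g" and C: "compact C" "C \<noteq> {}"
  shows "\<exists>p\<in>C. \<forall>y\<in>C. g p \<le> g y"
proof (rule ccontr)
  assume no: "\<not> ?thesis"
  define P where "P y S \<longleftrightarrow> open S \<and> y \<in> S \<and> (\<exists>w\<in>C. \<forall>s\<in>S. g w < g s)" for y S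
  have "\<exists>S. P y S" if y: "y \<in> C" for y
  proof -
    obtain w where w: "w \<in> C" "g w < g y" using no y by (auto simp: not_le)
    from lsc_eventually_less[OF g w(2)] show ?thesis
      using w(1) unfolding P_def eventually_nhds by metis
  qed
  then obtain S where S: "\<And>y. y \<in> C \<Longrightarrow> P y (S y)" by metis
  then have op: "\<And>y. y \<in> C \<Longrightarrow> open (S y)" and cov: "C \<subseteq> (\<Union>y\<in>C. S y)" by (auto simp: P_def)
  obtain T where T: "T \<subseteq> C" "finite T" "C \<subseteq> (\<Union>y\<in>T. S y)"
    by (rule compactE_image[OF C(1) op cov])
  have "T \<noteq> {}" using T C by auto
  from S obtain w where w: "\<And>y. y \<in> C \<Longrightarrow> w y \<in> C \<and> (\<forall>s\<in>S y. g (w y) < g s)"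
    unfolding P_def by metis
  obtain t where t: "t \<in> T" "\<And>t'. t' \<in> T \<Longrightarrow> g (w t) \<le> g (w t')"
    using arg_min_if_finite[OF T(2) \<open>T \<noteq> {}\<close>, of "\<lambda>t. g (w t)"] by (meson not_le)
  have "w t \<in> C" using t w T by auto
  then obtain t' where "t' \<in> T" "w t \<in> S t'" using T by auto
  then show False using w[of t'] T(1) t(2)[of t'] by (auto simp: not_le[symmetric])
qed

lemma lsc_add_continuous:
  fixes r :: "'a::topological_space \<Rightarrow> real"
  assumes g: "lsc g" "\<And>x. g x \<noteq> - \<infinity>" and r: "continuous_on UNIV r"
  shows "lsc (\<lambda>x. g x + ereal (r x))"
  unfolding lsc_def
proof (intro allI)
  fix x
  show "g x + ereal (r x) \<le> Liminf (at x) (\<lambda>y. g y + ereal (r y))"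
    unfolding le_Liminf_iff
  proof (intro allI impI)
    fix c assume c: "c < g x + ereal (r x)"
    show "\<forall>\<^sub>F y in at x. c < g y + ereal (r y)"
    proof (cases c)
      case (real c')
      then have "ereal (c' - r x) < g x" using c by (cases "g x") auto
      \<comment> \<open>The slack is split at \<open>e\<close>: near \<open>x\<close> the first
        summand stays above \<open>e\<close> and the second above \<open>c' - e\<close>.\<close>
      then obtain e where e: "ereal (c' - r x) < ereal e" "ereal e < g x" using ereal_dense2 by blast
      have "(r \<longlongrightarrow> r x) (at x)" using r by (simp add: continuous_on_def)
      then have "\<forall>\<^sub>F y in at x. c' - e < r y" by (rule order_tendstoD) (use e in simp)
      moreover have "\<forall>\<^sub>F y in at x. ereal e < g y"
        using lsc_eventually_less[OF g(1) e(2)] by (simp add: eventually_nhds_conv_at)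
      ultimately show ?thesis
      proof eventually_elim
        case (elim y) then show ?case using real g(2)[of y] by (cases "g y") auto
      qed
    next
      case MInf then show ?thesis using g(2) by (auto intro!: always_eventually)
    qed (use c in auto)
  qed
qed

text \<open>One-sided first-order condition: after division by \<open>t\<close> the term with
  \<open>b\<close> vanishes as \<open>t\<close> tends to \<open>0\<close>. A single \<open>t\<close>
  that keeps \<open>t * b\<close> below \<open>- a / 2\<close> suffices.\<close>

lemma quadratic_upper_bound_0:
  fixes a b :: real
  assumes "\<And>t. 0 < t \<Longrightarrow> t \<le> 1 \<Longrightarrow> 0 \<le> t * a + t\<^sup>2 * b"
  shows "0 \<le> a"
proof (rule ccontr)
  assume a: "\<not> 0 \<le> a"
  define t where "t = min 1 (- a / (2 * (\<bar>b\<bar> + 1)))"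
  have t: "0 < t" "t \<le> 1" using a divide_pos_pos[of "- a" "2 * (\<bar>b\<bar> + 1)"] by (auto simp: t_def)
  have "t * (\<bar>b\<bar> + 1) \<le> - a / 2"
  proof -
    have "t \<le> - a / (2 * (\<bar>b\<bar> + 1))" by (simp add: t_def)
    then have "t * (2 * (\<bar>b\<bar> + 1)) \<le> - a" by (subst (asm) pos_le_divide_eq) auto
    then have "2 * (t * (\<bar>b\<bar> + 1)) \<le> - a" by (simp only: mult.left_commute)
    then show ?thesis by linarith
  qed
  moreover have "t * b \<le> t * (\<bar>b\<bar> + 1)" using t by (intro mult_left_mono) auto
  ultimately have "a + t * b < 0" using a by linarith
  then have "t * (a + t * b) < 0" using t by (simp add: mult_pos_neg)
  then show False using assms[OF t] by (simp add: algebra_simps power2_eq_square)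
qed

section \<open>Proximal maps of proper lower semicontinuous convex functions\<close>

locale proper_lsc_convex =
  fixes g :: "'a::euclidean_space \<Rightarrow> ereal"
  assumes proper: "proper g" and lsc: "lsc g" and convex: "econvex g"
begin

abbreviation "gr \<equiv> \<lambda>x. real_of_ereal (g x)"

lemma not_MInf: "g x \<noteq> - \<infinity>" using proper by (simp add: proper_def)

lemma ereal_gr: "x \<in> edom g \<Longrightarrow> ereal (gr x) = g x"
  using not_MInf[of x] by (cases "g x") (auto simp: edom_def)

lemma edom_ereal: "x \<in> edom g \<Longrightarrow> \<exists>r. g x = ereal r"
  using ereal_gr by metis

lemma convex_edom: "convex (edom g)"
  using convex by (simp add: econvex_def convex_on_imp_convex)

lemma gr_convex:
  assumes "x \<in> edom g" "y \<in> edom g" "0 \<le> t" "t \<le> 1"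
  shows "x + t *\<^sub>R (y - x) \<in> edom g" "gr (x + t *\<^sub>R (y - x)) \<le> (1 - t) * gr x + t * gr y"
proof -
  have e: "x + t *\<^sub>R (y - x) = (1 - t) *\<^sub>R x + t *\<^sub>R y" by (simp add: algebra_simps)
  show "x + t *\<^sub>R (y - x) \<in> edom g" unfolding e
    using convexD_alt[OF convex_edom] assms by auto
  show "gr (x + t *\<^sub>R (y - x)) \<le> (1 - t) * gr x + t * gr y" unfolding e
    using convex_onD[of "edom g" gr t x y] convex assms by (simp add: econvex_def)
qed

text \<open>Along rays from \<open>y0\<close>, convexity extends the lower bound on the unit ball around \<open>y0\<close>.\<close>

lemma linear_lower_bound:
  assumes y0: "y0 \<in> edom g"
  shows "\<exists>M\<ge>0. \<forall>y\<in>edom g. - (M * norm (y - y0)) - M \<le> gr y"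
proof -
  obtain p where "p \<in> cball y0 1" and p: "\<forall>y\<in>cball y0 1. g p \<le> g y"
    using lsc_attains_inf[OF lsc, of "cball y0 1"] by auto
  then have "g p \<le> g y0" by simp
  then have pd: "p \<in> edom g" using y0 by (auto simp: edom_def)
  define M where "M = \<bar>gr p\<bar> + \<bar>gr y0\<bar>"
  have M: "M \<ge> 0" unfolding M_def by (intro add_nonneg_nonneg abs_ge_zero)
  have lb: "- \<bar>gr p\<bar> \<le> gr y" if "y \<in> cball y0 1" "y \<in> edom g" for y
  proof -
    have "ereal (gr p) \<le> ereal (gr y)" using p that pd by (simp add: ereal_gr)
    then have "gr p \<le> gr y" by simp
    then show ?thesis by linarith
  qed
  have "- (M * norm (y - y0)) - M \<le> gr y" if y: "y \<in> edom g" for y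
  proof (cases "norm (y - y0) \<le> 1")
    case True
    have "0 \<le> M * norm (y - y0)" using M by simp
    moreover have "- \<bar>gr p\<bar> \<le> gr y" using lb[of y] y True by (simp add: dist_norm norm_minus_commute)
    ultimately show ?thesis using abs_ge_zero[of "gr y0"] unfolding M_def by linarith
  next
    case False
    define t where "t = norm (y - y0)"
    have t: "t > 1" using False by (simp add: t_def)
    let ?z = "y0 + (1 / t) *\<^sub>R (y - y0)"
    have z: "?z \<in> edom g" "gr ?z \<le> (1 - 1 / t) * gr y0 + (1 / t) * gr y"
      using gr_convex[OF y0 y, of "1 / t"] t by auto
    have "?z \<in> cball y0 1" using t by (simp add: dist_norm t_def)
    then have "- \<bar>gr p\<bar> \<le> (1 - 1 / t) * gr y0 + (1 / t) * gr y" using lb z by fastforce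
    then have "t * (- \<bar>gr p\<bar>) \<le> t * ((1 - 1 / t) * gr y0 + (1 / t) * gr y)"
      by (rule mult_left_mono) (use t in linarith)
    also have "\<dots> = (t - 1) * gr y0 + gr y" using t by (simp add: field_simps)
    also have "(t - 1) * gr y0 \<le> t * \<bar>gr y0\<bar>" 
    proof -
      have "(t - 1) * x \<le> (t - 1) * \<bar>x\<bar>" "(t - 1) * \<bar>x\<bar> \<le> t * \<bar>x\<bar>" for x :: real
        using t by (auto intro: mult_left_mono mult_right_mono)
      then show ?thesis by (rule order_trans)
    qed
    finally have "- (M * t) \<le> gr y" by (simp add: M_def algebra_simps)
    then show ?thesis using M by (simp add: t_def)
  qed
  then show ?thesis using M by blast
qed

text \<open>The squared distance outgrows the linear lower bound on \<open>g\<close>, so a minimizer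
  over a large enough ball is a global one.\<close>

lemma prox_exists: "\<exists>p. \<forall>y. g p + ereal ((norm (p - u))\<^sup>2 / 2) \<le> g y + ereal ((norm (y - u))\<^sup>2 / 2)"
proof -
  let ?h = "\<lambda>y. g y + ereal ((norm (y - u))\<^sup>2 / 2)"
  obtain y0 where y0: "y0 \<in> edom g" using proper by (auto simp: proper_def)
  obtain M where M: "M \<ge> 0" "\<And>y. y \<in> edom g \<Longrightarrow> - (M * norm (y - y0)) - M \<le> gr y"
    using linear_lower_bound[OF y0] by blast
  define h0 where "h0 = gr y0 + (norm (y0 - u))\<^sup>2 / 2"
  define s where "s = norm (y0 - u)"
  \<comment> \<open>Outside the ball, \<open>v = norm (y - y0) - s\<close> exceeds \<open>w\<close>.
    The part \<open>2 * M + 2\<close> of \<open>w\<close> gives \<open>v / 2 - M \<ge> 1\<close>,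
    and the rest lifts \<open>v - s * M - M\<close> above the value \<open>h0\<close> at
    \<open>y0\<close>.\<close>
  define w where "w = 2 * M + 2 + \<bar>h0\<bar> + s * M + M"
  have s: "s \<ge> 0" by (simp add: s_def)
  have h0: "?h y0 = ereal h0" using edom_ereal[OF y0] by (auto simp: h0_def)
  have lsc_h: "lsc ?h"
    by (intro lsc_add_continuous lsc not_MInf continuous_intros) simp
  have sM: "0 \<le> s * M" using s M by simp
  have w0: "w \<ge> 0" using M sM by (simp add: w_def)
  obtain p where pC: "p \<in> cball y0 (s + w)" and p: "\<And>y. y \<in> cball y0 (s + w) \<Longrightarrow> ?h p \<le> ?h y"
    using lsc_attains_inf[OF lsc_h, of "cball y0 (s + w)"] s w0 by auto
  have "?h p \<le> ?h y" for y
  proof (cases "y \<in> cball y0 (s + w)")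
    case False
    have py0: "?h p \<le> ?h y0" using p s w0 by simp
    show ?thesis
    proof (cases "y \<in> edom g")
      case True
      define v where "v = norm (y - y0) - s"
      have v: "v > w" using False by (simp add: v_def dist_norm norm_minus_commute)
      have vn: "v \<le> norm (y - u)"
        using norm_triangle_ineq[of "y - u" "u - y0"] by (simp add: v_def s_def norm_minus_commute)
      have wM: "w \<ge> 2 * M + 2" using sM M by (simp add: w_def)
      have "h0 \<le> v - s * M - M" using v M by (simp add: w_def)
      also have "v \<le> v * (v / 2 - M)"
      proof -
        have "1 \<le> v / 2 - M" using v wM by linarith
        then have "v * 1 \<le> v * (v / 2 - M)" using v w0 by (intro mult_left_mono) auto
        then show ?thesis by simp
      qed
      also have "v * (v / 2 - M) - s * M - M = - (M * norm (y - y0)) - M + v\<^sup>2 / 2"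
        by (simp add: v_def algebra_simps power2_eq_square)
      also have "\<dots> \<le> gr y + (norm (y - u))\<^sup>2 / 2"
      proof -
        have "v\<^sup>2 \<le> (norm (y - u))\<^sup>2" using vn v w0 by (intro power_mono) auto
        then show ?thesis using M(2)[OF True] by linarith
      qed
      finally have "?h y0 \<le> ?h y" unfolding h0 using edom_ereal[OF True] by auto
      then show ?thesis using py0 by order
    next
      case False then show ?thesis by (simp add: edom_def)
    qed
  qed (rule p)
  then show ?thesis by blast
qed

text \<open>\<open>prox\<close> is a choice among minimizers, so the existence of one carries over
  to the chosen point.\<close>

lemma prox_min: "g (prox g u) + ereal ((norm (prox g u - u))\<^sup>2 / 2) \<le> g y + ereal ((norm (y - u))\<^sup>2 / 2)"
proof -
  let ?h = "\<lambda>y. g y + ereal ((norm (y - u))\<^sup>2 / 2)"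
  obtain p where "\<forall>y. ?h p \<le> ?h y" using prox_exists by blast
  then have "is_arg_min ?h (\<lambda>y. True) p" by (simp add: is_arg_min_linorder)
  then have "is_arg_min ?h (\<lambda>y. True) (prox g u)"
    unfolding prox_def arg_min_def by (rule someI)
  then show ?thesis by (simp add: is_arg_min_linorder)
qed

lemma prox_in_edom: "prox g u \<in> edom g"
proof -
  obtain y0 where y0: "y0 \<in> edom g" using proper by (auto simp: proper_def)
  then show ?thesis using prox_min[of u y0] by (auto simp: edom_def)
qed

text \<open>The optimality condition: \<open>u - prox g u\<close> is a subgradient at the proximal
  point. Minimality is tested along the segment to \<open>y\<close>; convexity bounds
  \<open>g\<close> there, and the squared norm contributes the inner product at first order in
  \<open>t\<close>.\<close>

lemma prox_subgradient:
  assumes y: "y \<in> edom g"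
  shows "gr (prox g u) + (u - prox g u) \<bullet> (y - prox g u) \<le> gr y"
proof -
  define p where "p = prox g u"
  have p: "p \<in> edom g" by (simp add: p_def prox_in_edom)
  have "0 \<le> (gr y - gr p) - (u - p) \<bullet> (y - p)"
  proof (rule quadratic_upper_bound_0[where b = "(norm (y - p))\<^sup>2 / 2"])
    fix t :: real assume t: "0 < t" "t \<le> 1"
    let ?z = "p + t *\<^sub>R (y - p)"
    have z: "?z \<in> edom g" "gr ?z \<le> (1 - t) * gr p + t * gr y"
      using gr_convex[OF p y, of t] t by auto
    have "ereal (gr p + (norm (p - u))\<^sup>2 / 2) \<le> ereal (gr ?z + (norm (?z - u))\<^sup>2 / 2)"
      using prox_min[of u ?z] edom_ereal[OF z(1)] edom_ereal[OF p] by (auto simp: p_def)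
    then have *: "gr p + (norm (p - u))\<^sup>2 / 2 \<le> gr ?z + (norm (?z - u))\<^sup>2 / 2" by simp
    have "(norm (?z - u))\<^sup>2 = (norm (p - u))\<^sup>2 - 2 * t * ((u - p) \<bullet> (y - p)) + t\<^sup>2 * (norm (y - p))\<^sup>2"
      unfolding power2_norm_eq_inner
      by (simp add: inner_diff_left inner_diff_right inner_add_left inner_add_right inner_commute
          power2_eq_square algebra_simps)
    with * z(2) have "gr p \<le> (1 - t) * gr p + t * gr y - t * ((u - p) \<bullet> (y - p)) + t\<^sup>2 * (norm (y - p))\<^sup>2 / 2"
      by argo
    then show "0 \<le> t * ((gr y - gr p) - (u - p) \<bullet> (y - p)) + t\<^sup>2 * ((norm (y - p))\<^sup>2 / 2)"
      by (simp add: algebra_simps)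
  qed
  then show ?thesis by (simp add: p_def)
qed

text \<open>The sum of two subgradient inequalities, each tested at the other point. Allowing any
  subgradient \<open>s\<close> at \<open>z\<close> makes it serve for a second proximal point as
  well as for a stationary point.\<close>

lemma prox_monotone:
  assumes z: "z \<in> edom g" and s: "\<And>y. y \<in> edom g \<Longrightarrow> gr z + s \<bullet> (y - z) \<le> gr y"
  shows "0 \<le> ((u - prox g u) - s) \<bullet> (prox g u - z)"
  using prox_subgradient[OF z, of u] s[OF prox_in_edom[of u]]
  by (simp add: inner_diff_left inner_diff_right)

text \<open>Monotonicity with the subgradient \<open>u - z\<close> at \<open>z\<close> leaves minus
  the squared distance of the two points, which therefore is zero.\<close>

lemma prox_eqI:
  assumes z: "z \<in> edom g" and s: "\<And>y. y \<in> edom g \<Longrightarrow> gr z + (u - z) \<bullet> (y - z) \<le> gr y"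
  shows "prox g u = z"
proof -
  have "0 \<le> ((u - prox g u) - (u - z)) \<bullet> (prox g u - z)" by (rule prox_monotone[OF assms])
  also have "\<dots> = - ((prox g u - z) \<bullet> (prox g u - z))" by (simp add: inner_diff_left)
  finally have "(prox g u - z) \<bullet> (prox g u - z) = 0" using inner_ge_zero[of "prox g u - z"] by linarith
  then show ?thesis by simp
qed

text \<open>Monotonicity between the two proximal points, followed by Cauchy-Schwarz.\<close>

lemma prox_nonexpansive: "norm (prox g u - prox g v) \<le> norm (u - v)"
proof -
  let ?w = "prox g u - prox g v"
  have "0 \<le> ((u - prox g u) - (v - prox g v)) \<bullet> ?w"
    by (rule prox_monotone[OF prox_in_edom prox_subgradient])
  also have "\<dots> = (u - v) \<bullet> ?w - (norm ?w)\<^sup>2" by (simp add: power2_norm_eq_inner inner_diff_left)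
  finally have "norm ?w * norm ?w \<le> norm (u - v) * norm ?w"
    using norm_cauchy_schwarz[of "u - v" ?w] by (simp add: power2_eq_square)
  then show ?thesis by (cases "?w = 0") auto
qed

end


section \<open>The composite problem\<close>

sublocale composite_problem \<subseteq> phi: proper_lsc_convex \<phi>
  using phi_proper phi_lsc phi_convex by unfold_locales

context composite_problem
begin

lemma smooth_neighbourhood:
  obtains U where "open U" "\<And>x. x \<in> edom \<phi> \<Longrightarrow> A *v x - b \<in> U" "\<And>y. y \<in> U \<Longrightarrow> \<psi> y < \<infinity>"
    "\<And>y. y \<in> U \<Longrightarrow> (\<lambda>y. real_of_ereal (\<psi> y)) differentiable (at y)"
    "\<And>y. y \<in> U \<Longrightarrow> grad (\<lambda>y. real_of_ereal (\<psi> y)) differentiable (at y)"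
  using smooth unfolding C2_on_def by (smt (verit) image_subset_iff subset_iff)

lemma f_finite: "x \<in> edom \<phi> \<Longrightarrow> \<exists>r. f x = ereal r"
proof -
  assume x: "x \<in> edom \<phi>"
  obtain U where "A *v x - b \<in> U" "\<And>y. y \<in> U \<Longrightarrow> \<psi> y < \<infinity>" using smooth_neighbourhood x by metis
  then have "f x \<noteq> \<infinity>" by (auto simp: f_def)
  moreover have "f x \<noteq> - \<infinity>" using psi_proper by (simp add: proper_def f_def)
  ultimately show ?thesis by (cases "f x") auto
qed

lemma f_derivatives:
  assumes x: "x \<in> edom \<phi>"
  shows f_has_derivative: "((\<lambda>x. real_of_ereal (f x)) has_derivative (\<lambda>h. h \<bullet> grad_f x)) (at x)"
    and grad_f_has_derivative: "(grad_f has_derivative (\<lambda>h. hess_f x *v h)) (at x)"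
    and hess_f_eq: "hess_f x *v v = transpose A *v (hess_psi (A *v x - b) *v (A *v v))"
    and hess_psi_symmetric: "u' \<bullet> (hess_psi (A *v x - b) *v v') = v' \<bullet> (hess_psi (A *v x - b) *v u')"
proof -
  let ?g = "\<lambda>y. real_of_ereal (\<psi> y)" and ?a = "\<lambda>x. A *v x - b" and ?f = "\<lambda>x. real_of_ereal (f x)"
  obtain U where U: "open U" "\<And>x. x \<in> edom \<phi> \<Longrightarrow> ?a x \<in> U"
    "\<And>y. y \<in> U \<Longrightarrow> ?g differentiable (at y)" "\<And>y. y \<in> U \<Longrightarrow> grad ?g differentiable (at y)"
    using smooth_neighbourhood by metis
  have da: "(?a has_derivative (\<lambda>h. A *v h)) (at y)" for y
    by (auto intro!: derivative_eq_intros bounded_linear_imp_has_derivative matrix_vector_mul_bounded_linear)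
  have fg: "?f = (\<lambda>x. ?g (?a x))" by (simp add: f_def)
  have df: "(?f has_derivative (\<lambda>h. h \<bullet> (transpose A *v grad ?g (?a y)))) (at y)" if "?a y \<in> U" for y
  proof -
    have "(?f has_derivative (\<lambda>h. (A *v h) \<bullet> grad ?g (?a y))) (at y)" unfolding fg
      by (rule has_derivative_compose[OF da grad_has_derivative[OF U(3)[OF that]]])
    then show ?thesis by (simp add: transpose_matrix_vector inner_commute[of "A *v _"] inner_commute[of _ "_ v* A"] dot_lmul_matrix)
  qed
  have gf: "grad ?f y = transpose A *v grad ?g (?a y)" if "?a y \<in> U" for y
    using df[OF that] by (intro grad_eqI) (simp add: gderiv_def)
  show "(?f has_derivative (\<lambda>h. h \<bullet> grad_f x)) (at x)"
    using df[OF U(2)[OF x]] gf[OF U(2)[OF x]] by (simp add: grad_f_def)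
  let ?V = "?a -` U"
  \<comment> \<open>The domain of \<open>\<phi>\<close> need not be open, but the chain rule for the
    gradient holds on the open preimage of \<open>U\<close>. The formula can therefore be
    differentiated once more at \<open>x\<close>, even at a boundary point of the domain.\<close>
  have V: "open ?V" by (intro open_vimage U continuous_intros linear_continuous_on matrix_vector_mul_bounded_linear)
  have dg: "(grad ?g has_derivative (\<lambda>h. hess ?g (?a x) *v h)) (at (?a x))"
    by (intro hess_has_derivative U x)
  have "((\<lambda>y. transpose A *v grad ?g (?a y)) has_derivative
      (\<lambda>h. transpose A *v (hess ?g (?a x) *v (A *v h)))) (at x)"
    by (rule bounded_linear.has_derivative[OF matrix_vector_mul_bounded_linear has_derivative_compose[OF da dg]])
  then have dgf: "(grad ?f has_derivative (\<lambda>h. transpose A *v (hess ?g (?a x) *v (A *v h)))) (at x)"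
    by (rule has_derivative_transform_within_open[OF _ V]) (use U x gf in auto)
  then have "grad ?f differentiable (at x)" by (auto simp: differentiable_def)
  from hess_has_derivative[OF this] show D: "(grad_f has_derivative (\<lambda>h. hess_f x *v h)) (at x)"
    by (simp add: grad_f_def hess_f_def)
  have "(\<lambda>h. hess_f x *v h) = (\<lambda>h. transpose A *v (hess ?g (?a x) *v (A *v h)))"
    using has_derivative_unique[OF D] dgf by (simp add: grad_f_def)
  then show "hess_f x *v v = transpose A *v (hess_psi (A *v x - b) *v (A *v v))"
    by (metis hess_psi_def)
  show "u' \<bullet> (hess_psi (A *v x - b) *v v') = v' \<bullet> (hess_psi (A *v x - b) *v u')"
    unfolding hess_psi_def by (rule second_derivative_symmetric[OF U(1) U(2)[OF x] U(3) dg])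
qed

lemma hess_f_quadratic_form:
  assumes "x \<in> edom \<phi>"
  shows "v \<bullet> (hess_f x *v v) = (A *v v) \<bullet> (hess_psi (A *v x - b) *v (A *v v))"
  using hess_f_eq[OF assms, of v] by (metis dot_lmul_matrix inner_commute transpose_matrix_vector)

lemma stationaryD:
  assumes "stationary z"
  shows stationary_edom: "z \<in> edom \<phi>"
    and stationary_subgradient:
      "y \<in> edom \<phi> \<Longrightarrow> real_of_ereal (\<phi> z) + (- grad_f z) \<bullet> (y - z) \<le> real_of_ereal (\<phi> y)"
    and stationary_residual: "residual z = 0"
proof -
  show z: "z \<in> edom \<phi>" using assms by (simp add: stationary_def)
  have "- grad_f z \<in> subdifferential \<phi> z"
  proof -
    obtain v where v: "v \<in> subdifferential \<phi> z" "0 = grad_f z + v"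
      using assms by (auto simp: stationary_def)
    then have "v = - grad_f z" by (metis minus_unique)
    then show ?thesis using v by simp
  qed
  then have sub: "\<phi> z + ereal ((- grad_f z) \<bullet> (y - z)) \<le> \<phi> y" for y
    by (auto simp: subdifferential_def)
  show s: "real_of_ereal (\<phi> z) + (- grad_f z) \<bullet> (y - z) \<le> real_of_ereal (\<phi> y)" if "y \<in> edom \<phi>" for y
    using sub[of y] phi.edom_ereal[OF z] phi.edom_ereal[OF that] by auto
  have "prox \<phi> (z - grad_f z) = z"
    by (rule phi.prox_eqI[OF z]) (use s in simp)
  then show "residual z = 0" by (simp add: residual_def)
qed

text \<open>With \<open>w = A *v v\<close> the quadratic form is that of the Hessian of
  \<open>\<psi>\<close> at \<open>w\<close> plus \<open>l * (w \<bullet> w)\<close>; the first part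
  is at least the smallest eigenvalue times \<open>w \<bullet> w\<close>, which \<open>l\<close>
  compensates.\<close>

lemma psd_mult:
  assumes x: "x \<in> edom \<phi>" and l: "max 0 (- lambda_min (hess_psi (A *v x - b))) \<le> l"
  shows "0 \<le> v \<bullet> ((hess_f x + l *\<^sub>R (transpose A ** A)) *v v)"
proof -
  let ?w = "A *v v"
  have "v \<bullet> ((transpose A ** A) *v v) = ?w \<bullet> ?w"
    by (metis dot_lmul_matrix inner_commute matrix_vector_mul_assoc transpose_matrix_vector)
  then have "v \<bullet> ((hess_f x + l *\<^sub>R (transpose A ** A)) *v v)
      = ?w \<bullet> (hess_psi (A *v x - b) *v ?w) + l * (?w \<bullet> ?w)"
    by (simp add: matrix_vector_mult_add_rdistrib scaleR_matrix_vector_assoc[symmetric] inner_add_right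
        hess_f_quadratic_form[OF x])
  moreover have "lambda_min (hess_psi (A *v x - b)) * (?w \<bullet> ?w) \<le> ?w \<bullet> (hess_psi (A *v x - b) *v ?w)"
    by (rule lambda_min_le[OF hess_psi_symmetric[OF x]])
  moreover have "- lambda_min (hess_psi (A *v x - b)) * (?w \<bullet> ?w) \<le> l * (?w \<bullet> ?w)"
    using l by (intro mult_right_mono) auto
  ultimately show ?thesis by linarith
qed

text \<open>Mean value inequality for the linearization error: on the segment from \<open>y\<close>
  to \<open>z\<close> the Hessian differs from the one at \<open>y\<close> by at most
  \<open>C * norm (z - y)\<close>.\<close>

lemma grad_f_taylor:
  assumes S: "convex S" "S \<subseteq> edom \<phi>" "y \<in> S" "z \<in> S" and C: "C \<ge> 0"
    and lip: "\<And>y z v. y \<in> S \<Longrightarrow> z \<in> S \<Longrightarrow> norm (hess_f y *v v - hess_f z *v v) \<le> C * norm (y - z) * norm v"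
  shows "norm (grad_f z - grad_f y - hess_f y *v (z - y)) \<le> C * (norm (z - y))\<^sup>2"
proof -
  let ?T = "closed_segment y z"
  have T: "?T \<subseteq> S" using S by (simp add: closed_segment_subset)
  have "norm (grad_f z - grad_f y - hess_f y *v (z - y)) \<le> norm (z - y) * (C * norm (z - y))"
  proof (rule differentiable_bound_linearization[where S = ?T and f' = "\<lambda>x h. hess_f x *v h"])
    show "y + t *\<^sub>R (z - y) \<in> ?T" if "t \<in> {0..1}" for t
      using that unfolding in_segment by (intro exI[of _ t]) (auto simp: algebra_simps)
    show "(grad_f has_derivative (*v) (hess_f x)) (at x within ?T)" if "x \<in> ?T" for x
      using grad_f_has_derivative[of x] that T S has_derivative_at_withinI by blast
    show "onorm ((\<lambda>v. hess_f x *v v) - (\<lambda>v. hess_f y *v v)) \<le> C * norm (z - y)" if x: "x \<in> ?T" for x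
      unfolding fun_diff_def
    proof (rule onorm_le)
      fix v
      have "norm (hess_f x *v v - hess_f y *v v) \<le> C * norm (x - y) * norm v"
        using T x S by (intro lip) auto
      also have "\<dots> \<le> C * norm (z - y) * norm v"
        using C segment_bound(1)[OF x] by (intro mult_right_mono mult_left_mono) auto
      finally show "norm (hess_f x *v v - hess_f y *v v) \<le> C * norm (z - y) * norm v" .
    qed
  qed auto
  then show ?thesis by (simp add: power2_eq_square algebra_simps)
qed

text \<open>The mean value theorem reduces the second-order remainder to \<open>z - y\<close> times
  the linearization error of the gradient, which is quadratic; hence the cube.\<close>

lemma f_taylor:
  assumes S: "convex S" "S \<subseteq> edom \<phi>" "y \<in> S" "z \<in> S" and C: "C \<ge> 0"
    and lip: "\<And>y z v. y \<in> S \<Longrightarrow> z \<in> S \<Longrightarrow> norm (hess_f y *v v - hess_f z *v v) \<le> C * norm (y - z) * norm v"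
  shows "\<bar>real_of_ereal (f z) - real_of_ereal (f y) - grad_f y \<bullet> (z - y) - (z - y) \<bullet> (hess_f y *v (z - y)) / 2\<bar>
    \<le> C * norm (z - y) ^ 3"
proof -
  let ?d = "z - y" and ?f = "\<lambda>x. real_of_ereal (f x)"
  \<comment> \<open>The remainder along the segment, so that \<open>h 1 - h 0\<close> is the
    expression to be bounded.\<close>
  define h where "h t = ?f (y + t *\<^sub>R ?d) - t * (grad_f y \<bullet> ?d) - t\<^sup>2 * (?d \<bullet> (hess_f y *v ?d)) / 2" for t
  have inS: "y + t *\<^sub>R ?d \<in> S" if "0 \<le> t" "t \<le> 1" for t
    using convexD_alt[OF S(1,3,4) that] by (simp add: algebra_simps)
  define h' where "h' t = ?d \<bullet> (grad_f (y + t *\<^sub>R ?d) - grad_f y - t *\<^sub>R (hess_f y *v ?d))" for t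
  have dh: "(h has_derivative (\<lambda>\<xi>. \<xi> * h' t)) (at t)" if t: "0 \<le> t" "t \<le> 1" for t
  proof -
    have "((\<lambda>t. y + t *\<^sub>R ?d) has_derivative (\<lambda>\<xi>. \<xi> *\<^sub>R ?d)) (at t)"
      by (auto intro!: derivative_eq_intros)
    from has_derivative_compose[OF this f_has_derivative] inS[OF t] S(2)
    have *: "((\<lambda>t. ?f (y + t *\<^sub>R ?d)) has_derivative (\<lambda>\<xi>. (\<xi> *\<^sub>R ?d) \<bullet> grad_f (y + t *\<^sub>R ?d))) (at t)"
      by auto
    have quad: "((\<lambda>t. t * c + t\<^sup>2 * e / 2) has_derivative (\<lambda>\<xi>. \<xi> * (c + t * e))) (at t)" for c e :: real
      by (auto intro!: derivative_eq_intros simp: algebra_simps)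
    have "h = (\<lambda>t. ?f (y + t *\<^sub>R ?d) - (t * (grad_f y \<bullet> ?d) + t\<^sup>2 * (?d \<bullet> (hess_f y *v ?d)) / 2))"
      by (simp add: h_def fun_eq_iff)
    moreover have "(\<lambda>\<xi>. \<xi> * h' t) = (\<lambda>\<xi>. (\<xi> *\<^sub>R ?d) \<bullet> grad_f (y + t *\<^sub>R ?d) - \<xi> * (grad_f y \<bullet> ?d + t * (?d \<bullet> (hess_f y *v ?d))))"
      unfolding h'_def inner_diff_right[of ?d] inner_scaleR_right inner_scaleR_left
      by (simp add: fun_eq_iff inner_commute[of "grad_f y" ?d] right_diff_distrib distrib_left)
    ultimately show ?thesis
      using has_derivative_diff[OF * quad[of "grad_f y \<bullet> ?d" "?d \<bullet> (hess_f y *v ?d)"]] by (simp only:)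
  qed
  have "\<exists>t\<in>{0<..<1}. h 1 - h 0 = (1 - 0) * h' t"
    by (rule mvt_simple) (simp, rule has_derivative_at_withinI[OF dh])
  then obtain t where t: "0 < t" "t < 1" and hm: "h 1 - h 0 = h' t" by auto
  have "\<bar>h' t\<bar> \<le> norm ?d * norm (grad_f (y + t *\<^sub>R ?d) - grad_f y - t *\<^sub>R (hess_f y *v ?d))"
    unfolding h'_def by (rule Cauchy_Schwarz_ineq2)
  also have "\<dots> \<le> norm ?d * (C * (norm ?d)\<^sup>2)"
  proof (rule mult_left_mono)
    have "norm (grad_f (y + t *\<^sub>R ?d) - grad_f y - hess_f y *v (y + t *\<^sub>R ?d - y)) \<le> C * (norm (y + t *\<^sub>R ?d - y))\<^sup>2"
      by (rule grad_f_taylor[OF S(1,2,3) inS C lip]) (use t in auto)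
    also have "\<dots> = C * (t * norm ?d)\<^sup>2" using t by simp
    also have "\<dots> \<le> C * (norm ?d)\<^sup>2"
      using t C by (intro mult_left_mono power_mono mult_left_le_one_le) auto
    finally show "norm (grad_f (y + t *\<^sub>R ?d) - grad_f y - t *\<^sub>R (hess_f y *v ?d)) \<le> C * (norm ?d)\<^sup>2"
      by (simp add: matrix_vector_mult_scaleR)
  qed auto
  finally have "\<bar>h 1 - h 0\<bar> \<le> C * norm ?d ^ 3" unfolding hm by (simp add: power3_eq_cube power2_eq_square mult_ac)
  then show ?thesis by (simp add: h_def)
qed

text \<open>The Hessian of \<open>f\<close> is the one of \<open>\<psi>\<close> between
  \<open>transpose A\<close> and \<open>A\<close>, so its Lipschitz bound costs norms of
  \<open>A\<close>; boundedness follows on a bounded set. The third bound says that the negative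
  part of the smallest eigenvalue grows at most linearly with the distance from a point with
  positive semidefinite Hessian.\<close>

lemma local_bounds:
  assumes S: "S \<subseteq> edom \<phi>" "z0 \<in> S" "\<And>y. y \<in> S \<Longrightarrow> norm (y - z0) \<le> \<epsilon>"
    and L: "L > 0" "\<And>y z. y \<in> S \<Longrightarrow> z \<in> S \<Longrightarrow>
      spectral_norm (hess_psi (A *v y - b) - hess_psi (A *v z - b)) \<le> L * norm (A *v y - A *v z)"
  shows "\<exists>C\<ge>1. (\<forall>y\<in>S. \<forall>z\<in>S. \<forall>v. norm (hess_f y *v v - hess_f z *v v) \<le> C * norm (y - z) * norm v) \<and>
    (\<forall>y\<in>S. \<forall>v. norm (hess_f y *v v) \<le> C * norm v) \<and>
    (\<forall>y\<in>S. \<forall>z\<in>S. \<forall>v. psd (hess_psi (A *v z - b)) \<longrightarrow>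
       max 0 (- lambda_min (hess_psi (A *v y - b))) * norm ((transpose A ** A) *v v) \<le> C * norm (y - z) * norm v)"
proof -
  define N where "N = max 1 (max (onorm ((*v) A)) (onorm ((*v) (transpose A))))"
  have N: "N \<ge> 1" by (simp add: N_def)
  have NA: "norm (A *v v) \<le> N * norm v" for v
  proof -
    have "norm (A *v v) \<le> onorm ((*v) A) * norm v"
      by (intro onorm matrix_vector_mul_bounded_linear)
    also have "\<dots> \<le> N * norm v" by (intro mult_right_mono) (auto simp: N_def)
    finally show ?thesis .
  qed
  have NT: "norm (transpose A *v v) \<le> N * norm v" for v
  proof -
    have "norm (transpose A *v v) \<le> onorm ((*v) (transpose A)) * norm v"
      by (intro onorm matrix_vector_mul_bounded_linear)
    also have "\<dots> \<le> N * norm v" by (intro mult_right_mono) (auto simp: N_def)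
    finally show ?thesis .
  qed
  have lip: "norm ((hess_psi (A *v y - b) - hess_psi (A *v z - b)) *v w) \<le> L * (N * norm (y - z)) * norm w"
    if "y \<in> S" "z \<in> S" for y z w
  proof -
    have "norm ((hess_psi (A *v y - b) - hess_psi (A *v z - b)) *v w)
        \<le> spectral_norm (hess_psi (A *v y - b) - hess_psi (A *v z - b)) * norm w"
      by (rule norm_spectral_norm)
    also have "\<dots> \<le> L * norm (A *v (y - z)) * norm w"
      using L(2)[OF that] by (intro mult_right_mono) (auto simp: matrix_vector_mult_diff_distrib)
    also have "\<dots> \<le> L * (N * norm (y - z)) * norm w"
      using L(1) NA by (intro mult_right_mono mult_left_mono) auto
    finally show ?thesis .
  qed
  \<comment> \<open>One factor \<open>N\<close> for the distance of the images under
    \<open>A\<close>, one for \<open>A *v v\<close> and one for \<open>transpose A\<close>.\<close>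
  define D where "D = L * N * N * N"
  have D: "D > 0" using L N by (auto simp: D_def)
  have 1: "norm (hess_f y *v v - hess_f z *v v) \<le> D * norm (y - z) * norm v" if "y \<in> S" "z \<in> S" for y z v
  proof -
    have "hess_f y *v v - hess_f z *v v
        = transpose A *v ((hess_psi (A *v y - b) - hess_psi (A *v z - b)) *v (A *v v))"
      using S that by (simp add: hess_f_eq subset_iff matrix_vector_mult_diff_distrib matrix_vector_mult_diff_rdistrib)
    also have "norm \<dots> \<le> N * (L * (N * norm (y - z)) * (N * norm v))"
    proof -
      have "norm ((hess_psi (A *v y - b) - hess_psi (A *v z - b)) *v (A *v v))
        \<le> L * (N * norm (y - z)) * norm (A *v v)" by (rule lip[OF that])
      also have "\<dots> \<le> L * (N * norm (y - z)) * (N * norm v)"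
        using L N NA by (intro mult_left_mono) auto
      finally show ?thesis using NT N by (smt (verit) mult_left_mono)
    qed
    finally show ?thesis by (simp add: D_def algebra_simps)
  qed
  define M where "M = onorm ((*v) (hess_f z0))"
  have M: "norm (hess_f z0 *v v) \<le> M * norm v" for v
    unfolding M_def by (intro onorm matrix_vector_mul_bounded_linear)
  have 2: "norm (hess_f y *v v) \<le> (M + D * \<epsilon>) * norm v" if "y \<in> S" for y v
  proof -
    have "norm (hess_f y *v v) \<le> norm (hess_f z0 *v v) + norm (hess_f y *v v - hess_f z0 *v v)"
      by (rule norm_triangle_sub)
    also have "\<dots> \<le> M * norm v + D * norm (y - z0) * norm v" by (intro add_mono M 1 that S)
    also have "\<dots> \<le> M * norm v + D * \<epsilon> * norm v"
      using D S(3)[OF that] by (intro add_mono mult_right_mono mult_left_mono) auto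
    finally show ?thesis by (simp add: algebra_simps)
  qed
  have 3: "max 0 (- lambda_min (hess_psi (A *v y - b))) * norm ((transpose A ** A) *v v) \<le> D * norm (y - z) * norm v"
    if y: "y \<in> S" and z: "z \<in> S" and p: "psd (hess_psi (A *v z - b))" for y z v
  proof -
    \<comment> \<open>\<open>w\<close> realizes the smallest eigenvalue at \<open>y\<close>. At
      \<open>z\<close> its quadratic form is nonnegative, so that eigenvalue cannot be more negative
      than the change of the Hessian allows.\<close>
    obtain w where w: "norm w = 1" "w \<bullet> (hess_psi (A *v y - b) *v w) = lambda_min (hess_psi (A *v y - b))"
      using lambda_min_attained[OF hess_psi_symmetric] S y by blast
    let ?E = "(hess_psi (A *v y - b) - hess_psi (A *v z - b)) *v w"
    have "lambda_min (hess_psi (A *v y - b)) = w \<bullet> (hess_psi (A *v z - b) *v w) + w \<bullet> ?E"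
      using w by (simp add: matrix_vector_mult_diff_rdistrib inner_diff_right)
    moreover have "0 \<le> w \<bullet> (hess_psi (A *v z - b) *v w)" using p by (simp add: psd_def)
    moreover have "\<bar>w \<bullet> ?E\<bar> \<le> L * (N * norm (y - z))"
      using Cauchy_Schwarz_ineq2[of w ?E] lip[OF y z, of w] w by simp
    ultimately have "- lambda_min (hess_psi (A *v y - b)) \<le> L * (N * norm (y - z))" by linarith
    moreover have "0 \<le> L * (N * norm (y - z))" using L N by simp
    ultimately have l: "max 0 (- lambda_min (hess_psi (A *v y - b))) \<le> L * (N * norm (y - z))" by simp
    have "norm ((transpose A ** A) *v v) \<le> N * norm (A *v v)"
      using NT[of "A *v v"] by (simp add: matrix_vector_mul_assoc)
    also have "\<dots> \<le> N * (N * norm v)" using NA N by (intro mult_left_mono) auto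
    finally have "max 0 (- lambda_min (hess_psi (A *v y - b))) * norm ((transpose A ** A) *v v)
        \<le> L * (N * norm (y - z)) * (N * (N * norm v))"
      using l L N by (intro mult_mono) auto
    then show ?thesis by (simp add: D_def algebra_simps)
  qed
  define C where "C = max 1 (max D (M + D * \<epsilon>))"
  have C: "C \<ge> 1" "C \<ge> D" "C \<ge> M + D * \<epsilon>" by (auto simp: C_def)
  have up: "D * norm (y - z) * norm v \<le> C * norm (y - z) * norm v" for y z :: "real^'n" and v :: "real^'n"
    using C by (intro mult_right_mono) auto
  have up2: "(M + D * \<epsilon>) * norm v \<le> C * norm v" for v :: "real^'n"
    using C by (intro mult_right_mono) auto
  show ?thesis
  proof (intro exI[of _ C] conjI ballI allI impI C(1))
    fix y z v assume "y \<in> S" "z \<in> S"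
    then show "norm (hess_f y *v v - hess_f z *v v) \<le> C * norm (y - z) * norm v"
      using 1 up order_trans by blast
  next
    fix y v assume "y \<in> S"
    then show "norm (hess_f y *v v) \<le> C * norm v" using 2 up2 order_trans by blast
  next
    fix y z v assume "y \<in> S" "z \<in> S" "psd (hess_psi (A *v z - b))"
    then show "max 0 (- lambda_min (hess_psi (A *v y - b))) * norm ((transpose A ** A) *v v) \<le> C * norm (y - z) * norm v"
      using 3 up order_trans by blast
  qed
qed

end


section \<open>Runs of the method\<close>

context reg_prox_newton
begin

abbreviation res :: "nat \<Rightarrow> real" where "res k \<equiv> norm (residual (x k))"
abbreviation fr :: "real^'n \<Rightarrow> real" where "fr y \<equiv> real_of_ereal (f y)"
abbreviation \<phi>r :: "real^'n \<Rightarrow> real" where "\<phi>r y \<equiv> real_of_ereal (\<phi> y)"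

lemma xhat_edom:
  assumes xk: "x k \<in> edom \<phi>"
  shows "xhat k \<in> edom \<phi>"
proof -
  obtain r where r: "f (x k) = ereal r" using f_finite[OF xk] by blast
  obtain s where s: "\<phi> (x k) = ereal s" using phi.edom_ereal[OF xk] by blast
  have "F (x k) - qhat k (xhat k) \<ge> ereal (\<alpha> * \<mu> k / 2 * (norm (xhat k - x k))\<^sup>2)"
    using xhat[of k] by (simp add: inexact_minimizer_def)
  then have "\<phi> (xhat k) \<noteq> \<infinity>" by (auto simp: qhat_def F_def r s)
  then show ?thesis by (simp add: edom_def)
qed

lemma iterate_edom: "x k \<in> edom \<phi>"
proof (induction k)
  case (Suc k) then show ?case using x_Suc[of k] xhat_edom by auto
qed (rule x_0)

lemma pred_eq: "pred k = \<phi>r (x k) - \<phi>r (xhat k) - grad_f (x k) \<bullet> d k - d k \<bullet> (hess_f (x k) *v d k) / 2"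
  using f_finite[OF iterate_edom[of k]] phi.edom_ereal[OF iterate_edom[of k]]
    phi.edom_ereal[OF xhat_edom[OF iterate_edom[of k]]]
  by (auto simp: pred_def q_def F_def d_def)

lemma ared_eq: "ared k = fr (x k) + \<phi>r (x k) - fr (xhat k) - \<phi>r (xhat k)"
  using f_finite[OF iterate_edom[of k]] phi.edom_ereal[OF iterate_edom[of k]]
    f_finite[OF xhat_edom[OF iterate_edom[of k]]] phi.edom_ereal[OF xhat_edom[OF iterate_edom[of k]]]
  by (auto simp: ared_def F_def)

lemma qhat_decrease:
  "\<alpha> * \<mu> k / 2 * (norm (d k))\<^sup>2 \<le> \<phi>r (x k) - \<phi>r (xhat k) - grad_f (x k) \<bullet> d k - d k \<bullet> (G k *v d k) / 2"
proof -
  have "F (x k) - qhat k (xhat k) \<ge> ereal (\<alpha> * \<mu> k / 2 * (norm (xhat k - x k))\<^sup>2)"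
    using xhat[of k] by (simp add: inexact_minimizer_def)
  then show ?thesis
    using f_finite[OF iterate_edom[of k]] phi.edom_ereal[OF iterate_edom[of k]]
      phi.edom_ereal[OF xhat_edom[OF iterate_edom[of k]]]
    by (auto simp: F_def qhat_def d_def)
qed

lemma G_mult: "G k *v v = hess_f (x k) *v v + \<Lambda> k *\<^sub>R ((transpose A ** A) *v v) + \<mu> k *\<^sub>R v"
  by (simp add: G_def H_def matrix_vector_mult_add_rdistrib scaleR_matrix_vector_assoc[symmetric])

lemma Lambda_ge: "max 0 (- lambda_min (hess_psi (A *v x k - b))) \<le> \<Lambda> k"
  using a mult_right_mono[of 1 a "max 0 (- lambda_min (hess_psi (A *v x k - b)))"]
  by (simp add: \<Lambda>_def)

lemma G_ge: "\<mu> k * (norm v)\<^sup>2 \<le> v \<bullet> (G k *v v)"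
proof -
  have "0 \<le> v \<bullet> (H k *v v)" unfolding H_def by (rule psd_mult[OF iterate_edom Lambda_ge])
  then show ?thesis
    by (simp add: G_def matrix_vector_mult_add_rdistrib scaleR_matrix_vector_assoc[symmetric]
        inner_add_right power2_norm_eq_inner)
qed

lemma nu_ge: "\<nu>_min \<le> \<nu> k"
proof (induction k)
  case (Suc k)
  have "\<nu>_min \<le> \<nu>_bar" using nu by linarith
  moreover have "1 * \<nu> k \<le> \<sigma>\<^sub>2 * \<nu> k" using sigma2 Suc nu by (intro mult_right_mono) auto
  ultimately show ?case using Suc by (simp add: nu_Suc)
qed (use nu in simp)

lemma mu_nonneg: "0 \<le> \<mu> k"
  using nu_ge[of k] nu by (simp add: \<mu>_def)

text \<open>\<open>pred k\<close> is the decrease of \<open>qhat k\<close>, which is nonnegative,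
  plus half of the quadratic form that \<open>G k\<close> adds to the Hessian of \<open>f\<close>;
  the part with \<open>\<Lambda> k\<close> is nonnegative and the part with \<open>\<mu> k\<close>
  is the bound.\<close>

lemma pred_ge: "\<mu> k / 2 * (norm (d k))\<^sup>2 \<le> pred k"
proof -
  have "d k \<bullet> ((transpose A ** A) *v d k) = (A *v d k) \<bullet> (A *v d k)"
    by (metis dot_lmul_matrix inner_commute matrix_vector_mul_assoc transpose_matrix_vector)
  then have "0 \<le> \<Lambda> k * (d k \<bullet> ((transpose A ** A) *v d k))"
    using Lambda_ge[of k] by (intro mult_nonneg_nonneg) auto
  moreover have "0 \<le> \<alpha> * \<mu> k / 2 * (norm (d k))\<^sup>2"
    using alpha mu_nonneg[of k] by simp
  ultimately show ?thesis
    using qhat_decrease[of k] unfolding pred_eq G_mult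
    by (simp add: inner_add_right power2_norm_eq_inner field_simps)
qed

text \<open>Either \<open>rbar j\<close> equals \<open>res j\<close>, and \<open>\<eta> < 1\<close>
  decides, or the last residual test failed and left \<open>rbar\<close> unchanged, and its failure
  is the claim. Hence an iterate that is merely repeated never passes the test.\<close>

lemma not_res_le_eta_rbar:
  assumes "residual (x j) \<noteq> 0"
  shows "\<eta> * rbar j < res j"
proof -
  have "\<eta> * res j < res j" using assms eta by simp
  then show ?thesis using rbar_0 rbar_Suc[of "j - 1"] by (cases j) (auto split: if_splits)
qed

text \<open>An index enters \<open>K\<close> only through an accepted step, which caps \<open>\<nu>\<close> by \<open>\<nu>_bar\<close>.\<close>

lemma in_K_D:
  assumes nz: "\<And>k. residual (x k) \<noteq> 0" and k: "k \<in> K"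
  shows "rbar k = res k" "\<nu> k \<le> \<nu>_bar"
proof -
  have "rbar k = res k \<and> \<nu> k \<le> \<nu>_bar"
  proof (cases k)
    case 0 then show ?thesis using rbar_0 nu by simp
  next
    case (Suc j)
    then have le: "res (Suc j) \<le> \<eta> * rbar j" using k by (auto simp: K_def)
    have "\<not> unsuccessful j"
    proof
      assume "unsuccessful j"
      then have "x (Suc j) = x j" by (simp add: x_Suc)
      then show False using le not_res_le_eta_rbar[OF nz, of j] by simp
    qed
    then have "\<nu> (Suc j) \<le> \<nu>_bar" by (simp add: nu_Suc)
    then show ?thesis using Suc le rbar_Suc[of j] by simp
  qed
  then show "rbar k = res k" "\<nu> k \<le> \<nu>_bar" by auto
qed

end


section \<open>One iteration near a strongly stationary point\<close>

lemma powr_eventually_small: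
  fixes c e :: real
  assumes "e > 0" "c > 0"
  shows "\<exists>s>0. \<forall>r. 0 \<le> r \<and> r < s \<longrightarrow> r powr e < c"
proof (intro exI[of _ "c powr (1 / e)"] conjI allI impI)
  fix r assume r: "0 \<le> r \<and> r < c powr (1 / e)"
  then have "r powr e < (c powr (1 / e)) powr e" using assms by (intro powr_less_mono2) auto
  then show "r powr e < c" using assms by (simp add: powr_powr)
qed (use assms in simp)

text \<open>One constant \<open>C\<close> serves for all three local bounds. The exponent of the
  error bound is called \<open>p\<close>, since \<open>q\<close> already denotes the quadratic
  model.\<close>

locale newton_near_solution =
  reg_prox_newton A b \<psi> \<phi> c\<^sub>1 c\<^sub>2 \<sigma>\<^sub>1 \<sigma>\<^sub>2 \<eta> \<theta> \<alpha> a \<nu>_min \<nu>_bar \<delta> \<tau> p_min \<kappa> x xhat \<nu> rbar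
  for A :: "real^'n^'m" and b :: "real^'m"
    and \<psi> :: "real^'m \<Rightarrow> ereal" and \<phi> :: "real^'n \<Rightarrow> ereal"
    and c\<^sub>1 c\<^sub>2 \<sigma>\<^sub>1 \<sigma>\<^sub>2 \<eta> \<theta> \<alpha> a \<nu>_min \<nu>_bar \<delta> \<tau> p_min \<kappa> :: real
    and x xhat :: "nat \<Rightarrow> real^'n" and \<nu> rbar :: "nat \<Rightarrow> real" +
  fixes xstar :: "real^'n" and \<epsilon> C \<beta> p :: real
  assumes nonzero: "residual (x k) \<noteq> 0"
    and xstar: "xstar \<in> strongly_stationary_points"
    and eps: "0 < \<epsilon>" and C: "1 \<le> C"
    and hess_lip: "y \<in> cball xstar \<epsilon> \<inter> edom \<phi> \<Longrightarrow> z \<in> cball xstar \<epsilon> \<inter> edom \<phi> \<Longrightarrow>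
      norm (hess_f y *v v - hess_f z *v v) \<le> C * norm (y - z) * norm v"
    and hess_bound: "y \<in> cball xstar \<epsilon> \<inter> edom \<phi> \<Longrightarrow> norm (hess_f y *v v) \<le> C * norm v"
    and curvature_bound: "y \<in> cball xstar \<epsilon> \<inter> edom \<phi> \<Longrightarrow> z \<in> cball xstar \<epsilon> \<inter> edom \<phi> \<Longrightarrow>
      psd (hess_psi (A *v z - b)) \<Longrightarrow>
      max 0 (- lambda_min (hess_psi (A *v y - b))) * norm ((transpose A ** A) *v v) \<le> C * norm (y - z) * norm v"
    and beta: "0 < \<beta>" and p: "max \<delta> (1 - \<delta>) < p" "1 / (1 + \<delta>) < p"
    and error_bound: "y \<in> cball xstar \<epsilon> \<inter> edom \<phi> \<Longrightarrow>
      \<beta> * infdist y strongly_stationary_points \<le> norm (residual y) powr p"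
begin

abbreviation B :: "(real^'n) set" where "B \<equiv> cball xstar \<epsilon> \<inter> edom \<phi>"
abbreviation X :: "(real^'n) set" where "X \<equiv> strongly_stationary_points"

section \<open>Constants valid near \<open>xstar\<close>\<close>

lemma convex_B: "convex B" using phi.convex_edom by (intro convex_Int convex_cball)

lemma X_edom: "X \<subseteq> edom \<phi>"
  by (auto simp: strongly_stationary_points_def stationary_edom)

lemma grad_f_taylor_B:
  assumes "y \<in> B" "z \<in> B"
  shows "norm (grad_f z - grad_f y - hess_f y *v (z - y)) \<le> C * (norm (z - y))\<^sup>2"
  by (rule grad_f_taylor[OF convex_B _ assms]) (use C hess_lip in auto)

text \<open>A Lipschitz constant of the residual: nonexpansiveness of the proximal map gives the
  \<open>2\<close>, and the gradient contributes \<open>C * (1 + 2 * \<epsilon>)\<close>, where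
  \<open>2 * \<epsilon>\<close> bounds the diameter of the ball.\<close>

definition Lr :: real where "Lr = 2 + C * (1 + 2 * \<epsilon>)"

lemma Lr: "Lr \<ge> 1" using C eps by (simp add: Lr_def)

lemma residual_lipschitz:
  assumes y: "y \<in> B" and z: "z \<in> B"
  shows "norm (residual y - residual z) \<le> Lr * norm (y - z)"
proof -
  have yz: "norm (z - y) \<le> 2 * \<epsilon>"
    using y z norm_triangle_ineq4[of "z - xstar" "y - xstar"] by (simp add: dist_norm norm_minus_commute)
  have "norm (grad_f z - grad_f y) \<le> norm (hess_f y *v (z - y)) + norm (grad_f z - grad_f y - hess_f y *v (z - y))"
    by (rule norm_triangle_sub)
  also have "\<dots> \<le> C * norm (z - y) + C * (norm (z - y))\<^sup>2"
    by (intro add_mono hess_bound grad_f_taylor_B y z)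
  also have "\<dots> \<le> C * norm (z - y) + C * (2 * \<epsilon> * norm (z - y))"
    unfolding power2_eq_square using C yz by (intro add_left_mono mult_left_mono mult_right_mono) auto
  finally have g: "norm (grad_f z - grad_f y) \<le> C * (1 + 2 * \<epsilon>) * norm (z - y)"
    by (simp add: algebra_simps)
  have "norm (residual y - residual z)
      \<le> norm (y - z) + norm (prox \<phi> (y - grad_f y) - prox \<phi> (z - grad_f z))"
    using norm_triangle_ineq4[of "y - z" "prox \<phi> (y - grad_f y) - prox \<phi> (z - grad_f z)"]
    by (simp add: residual_def algebra_simps)
  also have "\<dots> \<le> norm (y - z) + norm ((y - grad_f y) - (z - grad_f z))"
    by (intro add_mono phi.prox_nonexpansive order_refl)
  also have "norm ((y - grad_f y) - (z - grad_f z)) \<le> norm (y - z) + norm (grad_f z - grad_f y)"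
    using norm_triangle_ineq[of "y - z" "grad_f z - grad_f y"] by (simp add: algebra_simps)
  finally show ?thesis using g by (simp add: Lr_def norm_minus_commute algebra_simps)
qed

lemma residual_le:
  assumes "y \<in> B" "z \<in> B" "z \<in> X"
  shows "norm (residual y) \<le> Lr * norm (y - z)"
  using residual_lipschitz[OF assms(1,2)] assms(3)
  by (simp add: strongly_stationary_points_def stationary_residual)

text \<open>Bounds the operator \<open>G k\<close>, with one summand each for the Hessian, the
  convexification and the regularization.\<close>

definition CG :: real where "CG = C + a * C * (2 * \<epsilon>) + \<nu>_bar"

lemma nu_bar: "0 < \<nu>_bar" using nu by linarith

lemma CG: "0 \<le> CG" unfolding CG_def using C eps nu_bar a by (intro add_nonneg_nonneg mult_nonneg_nonneg) auto

text \<open>The error bound gives \<open>1 / \<beta>\<close>; the \<open>2\<close> pays for a point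
  of \<open>X\<close> that is only nearly the closest one.\<close>

definition E :: real where "E = 2 / \<beta>"

lemma E_nonneg: "0 \<le> E" using beta by (simp add: E_def)

text \<open>The summands stem from the inexactness of the step, from the Taylor remainder together
  with the convexification, and from the regularization. The divisor comes from the lower bound
  \<open>\<nu>_min * r powr \<delta>\<close> on \<open>\<mu> k\<close>.\<close>

definition Cp :: real where "Cp = ((1 + CG) * Lr + (1 + a) * C * E + \<nu>_bar) / \<nu>_min"

lemma Cp: "0 \<le> Cp"
  using CG Lr C E_nonneg nu_bar nu a by (simp add: Cp_def)

definition Cd :: real where "Cd = Cp + 1 + Lr"

lemma Cd: "1 \<le> Cd" using Cp Lr by (simp add: Cd_def)

definition Cr :: real where "Cr = C * Cd * Cd * E + a * C * Cd * E + \<nu>_bar * Cd"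

lemma Cr: "0 \<le> Cr" using C Cd E_nonneg a nu_bar by (simp add: Cr_def)

end

text \<open>The last assumption is the form in which the error bound is used: it follows from
  \<open>infdist (x k) X \<le> r powr p / \<beta>\<close>, \<open>\<delta> < p\<close> and \<open>r \<le> 1\<close>.\<close>

locale newton_step = newton_near_solution +
  fixes k :: nat and z :: "real^'a"
  assumes k: "k \<in> K" and xk: "x k \<in> cball xstar \<epsilon>" and z: "z \<in> cball xstar \<epsilon>" "z \<in> strongly_stationary_points"
    and res_le_1: "norm (residual (x k)) \<le> 1"
    and t_le: "norm (x k - z) \<le> E * norm (residual (x k)) powr \<delta>"
begin

abbreviation "t \<equiv> norm (x k - z)"
abbreviation "r \<equiv> res k"

lemma xB: "x k \<in> B" using xk iterate_edom by simp
lemma zB: "z \<in> B" using z X_edom by auto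

lemma r_pos: "r > 0" using nonzero by simp
lemma r_le: "r \<le> Lr * t" by (rule residual_le[OF xB zB z(2)])
lemma t_nonneg: "0 \<le> t" by simp

text \<open>The error bound at work: terms quadratic in \<open>t\<close> become of the order of
  \<open>\<mu> k * t\<close>, so that division by \<open>\<mu> k\<close> leaves
  \<open>O(t)\<close>.\<close>

lemma t_sq_le: "t * t \<le> E * (r powr \<delta> * t)"
  using mult_right_mono[OF t_le t_nonneg] by (simp only: mult.assoc)

lemma mu_eq: "\<mu> k = \<nu> k * r powr \<delta>"
  using in_K_D(1)[OF nonzero k] by (simp add: \<mu>_def)

lemma mu_bounds: "\<nu>_min * r powr \<delta> \<le> \<mu> k" "\<mu> k \<le> \<nu>_bar * r powr \<delta>" "\<mu> k \<le> \<nu>_bar"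
proof -
  show "\<nu>_min * r powr \<delta> \<le> \<mu> k" "\<mu> k \<le> \<nu>_bar * r powr \<delta>"
    unfolding mu_eq using nu_ge in_K_D(2)[OF nonzero k] by (auto intro: mult_right_mono)
  have "\<nu>_bar * r powr \<delta> \<le> \<nu>_bar"
    using nu_bar delta res_le_1 by (simp add: mult_left_le powr_le1)
  then show "\<mu> k \<le> \<nu>_bar" using \<open>\<mu> k \<le> \<nu>_bar * r powr \<delta>\<close> by simp
qed

lemma Lambda_bound: "norm (\<Lambda> k *\<^sub>R ((transpose A ** A) *v v)) \<le> a * C * t * norm v"
proof -
  have "psd (hess_psi (A *v z - b))" using z by (simp add: strongly_stationary_points_def)
  from curvature_bound[OF xB zB this, of v]
  have "a * (max 0 (- lambda_min (hess_psi (A *v x k - b))) * norm ((transpose A ** A) *v v)) \<le> a * (C * t * norm v)"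
    using a by (intro mult_left_mono) auto
  then show ?thesis using a by (simp add: \<Lambda>_def abs_mult mult.assoc)
qed

lemma G_bound: "norm (G k *v v) \<le> CG * norm v"
proof -
  have t2: "t \<le> 2 * \<epsilon>"
    using xk z norm_triangle_ineq4[of "x k - xstar" "z - xstar"] by (simp add: dist_norm norm_minus_commute)
  have "norm (G k *v v) \<le> norm (hess_f (x k) *v v) + norm (\<Lambda> k *\<^sub>R ((transpose A ** A) *v v)) + norm (\<mu> k *\<^sub>R v)"
    unfolding G_mult by (intro norm_triangle_le add_right_mono norm_triangle_ineq)
  also have "\<dots> \<le> C * norm v + a * C * t * norm v + \<nu>_bar * norm v"
    using mu_bounds(3) mu_nonneg[of k] by (intro add_mono hess_bound xB Lambda_bound) (auto intro: mult_right_mono)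
  also have "\<dots> \<le> C * norm v + a * C * (2 * \<epsilon>) * norm v + \<nu>_bar * norm v"
    using t2 a C by (intro add_mono mult_right_mono mult_left_mono) auto
  finally show ?thesis by (simp add: CG_def algebra_simps)
qed

lemma R_le: "norm (R k (xhat k)) \<le> \<theta> * min r (r powr (1 + \<tau>))"
  using xhat[of k] by (simp add: inexact_minimizer_def)

lemma R_le_powr: "norm (R k (xhat k)) \<le> r powr (1 + \<tau>)"
proof -
  have "\<theta> * min r (r powr (1 + \<tau>)) \<le> 1 * r powr (1 + \<tau>)"
    using theta r_pos by (intro mult_mono) auto
  then show ?thesis using R_le by simp
qed

lemma powr_tau_le: "r powr (1 + \<tau>) \<le> r powr \<delta> * r"
proof -
  have "r powr (1 + \<tau>) \<le> r powr (\<delta> + 1)" using tau res_le_1 r_pos by (intro powr_mono') auto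
  then show ?thesis using r_pos by (simp add: powr_add)
qed

text \<open>Monotonicity of the subdifferential, tested at the exact proximal point and at \<open>z\<close>;
  the term \<open>E * (r powr \<delta> * t)\<close> absorbs the quadratic Taylor remainder.\<close>

lemma prox_point_bound: "norm (xhat k - R k (xhat k) - z) \<le> Cp * t"
proof -
  define u where "u = xhat k - grad_f (x k) - G k *v d k"
  define y where "y = prox \<phi> u"
  define e where "e = R k (xhat k)"
  have y: "y = xhat k - e" by (simp add: y_def e_def R_def u_def d_def)
  have dk: "d k = (y - z) + (z - x k) + e" by (simp add: y d_def)
  define w where "w = grad_f z - grad_f (x k) - hess_f (x k) *v (z - x k)"
  have w: "norm w \<le> C * (t * t)"
    using grad_f_taylor_B[OF xB zB] by (simp add: w_def norm_minus_commute power2_eq_square)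
  let ?L = "\<Lambda> k *\<^sub>R ((transpose A ** A) *v (z - x k))"
  let ?m = "\<mu> k *\<^sub>R (z - x k)"
  have e: "norm e \<le> r powr \<delta> * (Lr * t)"
  proof -
    have "norm e \<le> r powr \<delta> * r" using R_le_powr powr_tau_le by (simp add: e_def)
    also have "\<dots> \<le> r powr \<delta> * (Lr * t)" by (intro mult_left_mono r_le) auto
    finally show ?thesis .
  qed
  have "0 \<le> (u - y - (- grad_f z)) \<bullet> (y - z)"
    unfolding y_def by (rule phi.prox_monotone) (use zB z in \<open>auto simp: strongly_stationary_points_def intro: stationary_subgradient[simplified]\<close>)
  \<comment> \<open>Splitting \<open>d k\<close> as in \<open>dk\<close> isolates
    \<open>G k *v (y - z)\<close>, whose inner product with \<open>y - z\<close> is at least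
    \<open>\<mu> k\<close> times the squared norm. Everything else is an error term.\<close>
  also have "u - y - (- grad_f z) = (e - G k *v e + w - ?L - ?m) - G k *v (y - z)"
    by (simp add: u_def y w_def G_mult dk[unfolded y] matrix_vector_right_distrib matrix_vector_mult_diff_distrib algebra_simps)
  finally have "(y - z) \<bullet> (G k *v (y - z)) \<le> (e - G k *v e + w - ?L - ?m) \<bullet> (y - z)"
    by (simp add: inner_diff_left[of _ "G k *v (y - z)"] inner_commute[of "y - z" "G k *v (y - z)"])
  also have "\<dots> \<le> norm (e - G k *v e + w - ?L - ?m) * norm (y - z)" by (rule norm_cauchy_schwarz)
  finally have "\<mu> k * (norm (y - z))\<^sup>2 \<le> norm (e - G k *v e + w - ?L - ?m) * norm (y - z)"
    using G_ge[of k "y - z"] by simp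
  then have "\<mu> k * norm (y - z) \<le> norm (e - G k *v e + w - ?L - ?m)"
    by (cases "y = z") (auto simp: power2_eq_square)
  also have "\<dots> \<le> norm e + norm (G k *v e) + norm w + norm ?L + norm ?m"
  proof -
    have "norm (v1 - v2 + v3 - v4 - v5) \<le> norm v1 + norm v2 + norm v3 + norm v4 + norm v5" for v1 v2 v3 v4 v5 :: "real^'a"
      by norm
    then show ?thesis .
  qed
  also have "\<dots> \<le> norm e + CG * norm e + C * (t * t) + a * C * t * t + \<nu>_bar * r powr \<delta> * t"
    using Lambda_bound[of "z - x k"] mu_bounds(2) mu_nonneg[of k] w
    by (intro add_mono G_bound order_refl) (auto simp: norm_minus_commute intro: mult_right_mono)
  also have "\<dots> = (1 + CG) * norm e + (1 + a) * C * (t * t) + \<nu>_bar * r powr \<delta> * t"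
    by (simp add: algebra_simps)
  also have "\<dots> \<le> (1 + CG) * (r powr \<delta> * (Lr * t)) + (1 + a) * C * (E * (r powr \<delta> * t)) + \<nu>_bar * r powr \<delta> * t"
    using CG C a by (intro add_mono mult_left_mono e t_sq_le order_refl mult_nonneg_nonneg) auto
  also have "\<dots> = (\<nu>_min * r powr \<delta>) * (Cp * t)" using nu by (simp add: Cp_def field_simps)
  finally have "\<mu> k * norm (y - z) \<le> (\<nu>_min * r powr \<delta>) * (Cp * t)" .
  \<comment> \<open>Replacing \<open>\<mu> k\<close> by its lower bound produces the same positive
    factor on both sides, which cancels.\<close>
  then have "(\<nu>_min * r powr \<delta>) * norm (y - z) \<le> (\<nu>_min * r powr \<delta>) * (Cp * t)"
    using mult_right_mono[OF mu_bounds(1) norm_ge_zero, of "y - z"] by linarith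
  then show ?thesis using nu r_pos by (simp add: y e_def)
qed

lemma step_bound: "norm (d k) \<le> Cd * t"
proof -
  have "\<theta> * min r (r powr (1 + \<tau>)) \<le> 1 * r" using theta r_pos by (intro mult_mono) auto
  then have e: "norm (R k (xhat k)) \<le> Lr * t" using R_le r_le by linarith
  have "d k = (xhat k - R k (xhat k) - z) - (x k - z) + R k (xhat k)" by (simp add: d_def)
  moreover have "norm (v1 - v2 + v3) \<le> norm v1 + norm v2 + norm v3" for v1 v2 v3 :: "real^'a"
    by norm
  ultimately have "norm (d k) \<le> norm (xhat k - R k (xhat k) - z) + norm (x k - z) + norm (R k (xhat k))"
    by (simp only:)
  then show ?thesis using e prox_point_bound by (simp add: Cd_def algebra_simps)
qed

text \<open>The arguments of the two proximal points differ by \<open>d k - G k *v d k\<close>, and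
  the inexactness is at most \<open>\<theta> * r\<close>, which the left side absorbs. So a nonzero
  residual forces a step of comparable size.\<close>

lemma residual_le_step: "(1 - \<theta>) * r \<le> (2 + CG) * norm (d k)"
proof -
  let ?P = "prox \<phi> (xhat k - grad_f (x k) - G k *v d k)" and ?Q = "prox \<phi> (x k - grad_f (x k))"
  have "residual (x k) = R k (xhat k) + (?P - ?Q) - d k"
    by (simp add: residual_def R_def d_def)
  moreover have "norm (v1 + v2 - v3) \<le> norm v1 + norm v2 + norm v3" for v1 v2 v3 :: "real^'a"
    by norm
  ultimately have "r \<le> norm (R k (xhat k)) + norm (?P - ?Q) + norm (d k)"
    by (simp only:)
  also have "norm (?P - ?Q) \<le> norm ((xhat k - grad_f (x k) - G k *v d k) - (x k - grad_f (x k)))"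
    by (rule phi.prox_nonexpansive)
  also have "\<dots> = norm (d k - G k *v d k)" by (simp add: d_def algebra_simps)
  also have "\<dots> \<le> norm (d k) + CG * norm (d k)"
    using norm_triangle_ineq4[of "d k" "G k *v d k"] G_bound[of "d k"] by linarith
  also have "norm (R k (xhat k)) \<le> \<theta> * r"
    using R_le theta mult_left_mono[of "min r (r powr (1 + \<tau>))" r \<theta>] by linarith
  finally show ?thesis by (simp add: algebra_simps)
qed

lemma d_nonzero: "0 < norm (d k)"
proof (rule ccontr)
  assume "\<not> 0 < norm (d k)"
  then have "d k = 0" by simp
  then have "(1 - \<theta>) * r \<le> 0" using residual_le_step by simp
  moreover have "0 < (1 - \<theta>) * r" using theta r_pos by simp
  ultimately show False by linarith
qed

text \<open>The residual at \<open>xhat k\<close> is compared with \<open>R k (xhat k)\<close>: the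
  proximal arguments differ by the Taylor remainder of the gradient and by the two terms added to
  the Hessian, all of them \<open>O(r powr \<delta> * t)\<close>.\<close>

lemma new_residual_bound:
  assumes xh: "xhat k \<in> cball xstar \<epsilon>"
  shows "norm (residual (xhat k)) \<le> r powr (1 + \<tau>) + Cr * (r powr \<delta> * t)"
proof -
  let ?P = "prox \<phi> (xhat k - grad_f (x k) - G k *v d k)" and ?Q = "prox \<phi> (xhat k - grad_f (xhat k))"
  have xhB: "xhat k \<in> B" using xh xhat_edom[OF iterate_edom] by simp
  define w where "w = grad_f (xhat k) - grad_f (x k) - hess_f (x k) *v d k"
  have dd: "norm (d k) * norm (d k) \<le> (Cd * t) * (Cd * t)" by (intro mult_mono step_bound) (use Cd in auto)
  have "norm w \<le> C * (norm (d k) * norm (d k))"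
    using grad_f_taylor_B[OF xB xhB] by (simp add: w_def d_def power2_eq_square)
  also have "\<dots> \<le> C * ((Cd * t) * (Cd * t))" using dd C by (intro mult_left_mono) auto
  finally have w: "norm w \<le> C * Cd * Cd * (t * t)" by (simp add: mult_ac)
  have L: "norm (\<Lambda> k *\<^sub>R ((transpose A ** A) *v d k)) \<le> a * C * Cd * (t * t)"
  proof -
    have "norm (\<Lambda> k *\<^sub>R ((transpose A ** A) *v d k)) \<le> a * C * t * norm (d k)" by (rule Lambda_bound)
    also have "\<dots> \<le> a * C * t * (Cd * t)" using a C by (intro mult_left_mono step_bound) auto
    finally show ?thesis by (simp add: mult_ac)
  qed
  have m: "norm (\<mu> k *\<^sub>R d k) \<le> (\<nu>_bar * r powr \<delta>) * (Cd * t)"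
    using mu_bounds(2) mu_nonneg[of k] step_bound nu_bar by (auto intro!: mult_mono)
  have "residual (xhat k) = R k (xhat k) + (?P - ?Q)" by (simp add: residual_def R_def d_def)
  then have "norm (residual (xhat k)) \<le> norm (R k (xhat k)) + norm (?P - ?Q)"
    by (simp only: norm_triangle_ineq)
  also have "norm (?P - ?Q) \<le> norm ((xhat k - grad_f (x k) - G k *v d k) - (xhat k - grad_f (xhat k)))"
    by (rule phi.prox_nonexpansive)
  also have "\<dots> = norm (w - \<Lambda> k *\<^sub>R ((transpose A ** A) *v d k) - \<mu> k *\<^sub>R d k)"
    by (simp add: w_def G_mult algebra_simps)
  also have "\<dots> \<le> norm w + norm (\<Lambda> k *\<^sub>R ((transpose A ** A) *v d k)) + norm (\<mu> k *\<^sub>R d k)"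
  proof -
    have "norm (v1 - v2 - v3) \<le> norm v1 + norm v2 + norm v3" for v1 v2 v3 :: "real^'a"
      by norm
    then show ?thesis .
  qed
  also have "\<dots> \<le> C * Cd * Cd * (t * t) + a * C * Cd * (t * t) + (\<nu>_bar * r powr \<delta>) * (Cd * t)"
    by (intro add_mono w L m)
  also have "\<dots> \<le> C * Cd * Cd * (E * (r powr \<delta> * t)) + a * C * Cd * (E * (r powr \<delta> * t)) + (\<nu>_bar * r powr \<delta>) * (Cd * t)"
    using C Cd a by (intro add_mono mult_left_mono t_sq_le order_refl mult_nonneg_nonneg) auto
  also have "\<dots> = Cr * (r powr \<delta> * t)" by (simp add: Cr_def algebra_simps)
  finally show ?thesis using R_le_powr by linarith
qed

text \<open>Both tests compare with \<open>pred k\<close>, which is at least of order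
  \<open>r powr \<delta> * (norm (d k))\<^sup>2\<close>. \<open>small1\<close> settles the decrease
  test, and \<open>small2\<close> makes the cubic model error at most a fraction
  \<open>1 - c\<^sub>1\<close> of \<open>pred k\<close>.\<close>

lemma step_accepted:
  assumes xh: "xhat k \<in> cball xstar \<epsilon>"
    and small1: "2 * (2 + CG) * p_min * r powr (\<kappa> - 1 - \<delta>) < \<nu>_min"
    and small2: "2 * C * Cd * t < (1 - c\<^sub>1) * \<nu>_min * r powr \<delta>"
  shows "\<not> unsuccessful k"
proof -
  have xhB: "xhat k \<in> B" using xh xhat_edom[OF iterate_edom] by simp
  let ?n = "norm (d k)"
  have pr: "\<nu>_min * r powr \<delta> * ?n\<^sup>2 \<le> 2 * pred k"
    using pred_ge[of k] mult_right_mono[OF mu_bounds(1), of "?n\<^sup>2"] by simp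
  have "p_min * (1 - \<theta>) * ?n * min r (r powr \<kappa>) < pred k"
  proof -
    \<comment> \<open>The first factor is small by \<open>small1\<close>, the second matches
      \<open>\<mu> k\<close>, and the last one is traded for \<open>norm (d k)\<close> by
      \<open>residual_le_step\<close>.\<close>
    have "r powr \<kappa> = r powr (\<kappa> - 1 - \<delta>) * r powr \<delta> * r"
    proof -
      have "r powr \<kappa> = r powr ((\<kappa> - 1 - \<delta>) + \<delta> + 1)" by simp
      also have "\<dots> = r powr (\<kappa> - 1 - \<delta>) * r powr \<delta> * r powr 1" by (simp only: powr_add)
      finally show ?thesis using r_pos by simp
    qed
    then have "2 * (2 + CG) * (p_min * (1 - \<theta>) * ?n * r powr \<kappa>)
        = (2 * (2 + CG) * p_min * r powr (\<kappa> - 1 - \<delta>)) * (r powr \<delta> * ?n * ((1 - \<theta>) * r))"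
      by (simp add: mult_ac)
    also have "\<dots> < \<nu>_min * (r powr \<delta> * ?n * ((1 - \<theta>) * r))"
      using d_nonzero r_pos theta by (intro mult_strict_right_mono small1) auto
    also have "\<dots> \<le> \<nu>_min * (r powr \<delta> * ?n * ((2 + CG) * ?n))"
      using nu by (intro mult_left_mono residual_le_step) auto
    also have "\<dots> = (2 + CG) * (\<nu>_min * r powr \<delta> * ?n\<^sup>2)" by (simp add: power2_eq_square mult_ac)
    also have "\<dots> \<le> (2 + CG) * (2 * pred k)" using CG by (intro mult_left_mono pr) auto
    finally have "(2 * (2 + CG)) * (p_min * (1 - \<theta>) * ?n * r powr \<kappa>) < (2 * (2 + CG)) * pred k" by (simp add: algebra_simps)
    then have lt: "p_min * (1 - \<theta>) * ?n * r powr \<kappa> < pred k"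
      by (rule mult_left_less_imp_less) (use CG in auto)
    have "p_min * (1 - \<theta>) * ?n * min r (r powr \<kappa>) \<le> p_min * (1 - \<theta>) * ?n * r powr \<kappa>"
      using p_min theta by (intro mult_left_mono) auto
    then show ?thesis using lt by linarith
  qed
  moreover have "c\<^sub>1 < \<rho> k"
  proof -
    have "0 < \<nu>_min * r powr \<delta> * ?n\<^sup>2" using nu r_pos d_nonzero by simp
    then have pos: "0 < pred k" using pr by linarith
    have "\<bar>fr (xhat k) - fr (x k) - grad_f (x k) \<bullet> d k - d k \<bullet> (hess_f (x k) *v d k) / 2\<bar> \<le> C * ?n ^ 3"
      unfolding d_def by (rule f_taylor[OF convex_B _ xB xhB]) (use C hess_lip in auto)
    then have ar: "pred k - C * ?n ^ 3 \<le> ared k" unfolding pred_eq ared_eq by linarith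
    have "2 * (C * ?n ^ 3) = 2 * C * ?n * ?n\<^sup>2" by (simp add: power3_eq_cube power2_eq_square)
    also have "\<dots> \<le> 2 * C * (Cd * t) * ?n\<^sup>2"
      using C by (intro mult_left_mono mult_right_mono step_bound) auto
    also have "\<dots> < (1 - c\<^sub>1) * \<nu>_min * r powr \<delta> * ?n\<^sup>2"
      using small2 d_nonzero by (intro mult_strict_right_mono) (auto simp: mult_ac)
    also have "\<dots> = (1 - c\<^sub>1) * (\<nu>_min * r powr \<delta> * ?n\<^sup>2)" by (simp add: mult_ac)
    also have "\<dots> \<le> (1 - c\<^sub>1) * (2 * pred k)" using c by (intro mult_left_mono pr) auto
    finally have "C * ?n ^ 3 < (1 - c\<^sub>1) * pred k" by simp
    then have "c\<^sub>1 * pred k < ared k" using ar by (simp add: algebra_simps)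
    then show ?thesis using pos by (simp add: \<rho>_def pos_less_divide_eq)
  qed
  ultimately show ?thesis by (simp add: unsuccessful_def)
qed

end


section \<open>Local superlinear convergence\<close>

context newton_near_solution
begin

definition s :: real where "s = min (1 + \<tau>) (\<delta> + p)"

lemma p_pos: "0 < p" and p_gt: "\<delta> < p" using p delta by auto

lemma s_gt_1: "1 < s" using p tau delta by (auto simp: s_def)

lemma rate_gt_1: "1 < (1 + \<delta>) * p"
  using p(2) delta by (simp add: pos_divide_less_eq mult.commute)

lemma X_nonempty: "X \<noteq> {}" using xstar by blast

lemma infdist_le_xstar: "infdist y X \<le> norm (y - xstar)"
  using infdist_le[OF xstar, of y] by (simp add: dist_norm)

text \<open>Nearly closest points stand in for a projection onto \<open>X\<close>, so that
  closedness of \<open>X\<close> does not enter.\<close>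

lemma infdist_less_obtains:
  assumes "infdist y X < e"
  obtains z where "z \<in> X" "norm (y - z) < e"
proof -
  have "bdd_below (dist y ` X)" by (rule bdd_belowI[of _ 0]) auto
  then have "\<exists>z\<in>X. dist y z < e"
    using assms cINF_less_iff[of X "dist y" e] X_nonempty by (simp add: infdist_notempty)
  then show thesis using that by (auto simp: dist_norm)
qed

text \<open>\<open>Cs\<close> bounds the new residual by a power of the old one, \<open>Cl\<close>
  by a power of the distance \<open>t\<close> to a point of \<open>X\<close>. The error bound at the
  new iterate turns \<open>Cl\<close> into \<open>Cdist\<close>, where the power of \<open>2\<close>
  reflects \<open>t \<le> 2 * infdist (x k) X\<close>.\<close>

definition Cs :: real where "Cs = 1 + Cr * E"
definition Cl :: real where "Cl = (Lr + Cr) * Lr powr \<delta>"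
definition Cdist :: real where "Cdist = (Cl * 2 powr (1 + \<delta>)) powr p / \<beta>"

lemma Cs: "1 \<le> Cs" using Cr E_nonneg by (simp add: Cs_def)

lemma Cl: "0 < Cl" using Cr Lr by (simp add: Cl_def)

lemma Cdist: "0 < Cdist" using Cl beta by (simp add: Cdist_def)

text \<open>The new residual is estimated twice. Eliminating \<open>t\<close> by the error bound
  gives the residual rate and membership in \<open>K\<close>; eliminating \<open>r\<close> by the
  Lipschitz bound, and then using the error bound at the new iterate, gives the distance
  rate.\<close>

lemma iteration_estimates:
  assumes k: "k \<in> K"
    and near: "norm (x k - xstar) \<le> \<epsilon> / (3 * Cd)"
    and r1: "res k \<le> 1"
    and accept1: "2 * (2 + CG) * p_min * res k powr (\<kappa> - 1 - \<delta>) < \<nu>_min"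
    and accept2: "2 * C * Cd * E * res k powr (p - \<delta>) < (1 - c\<^sub>1) * \<nu>_min"
    and decrease: "Cs * res k powr (s - 1) \<le> \<eta>"
  shows "Suc k \<in> K" "norm (x (Suc k) - x k) \<le> 2 * Cd * infdist (x k) X"
    "res (Suc k) \<le> Cs * res k powr s" "infdist (x (Suc k)) X \<le> Cdist * infdist (x k) X powr ((1 + \<delta>) * p)"
proof -
  define D where "D = infdist (x k) X"
  define r where "r = res k"
  have r: "0 < r" "r \<le> 1" using nonzero r1 by (auto simp: r_def)
  have "\<epsilon> / (3 * Cd) \<le> \<epsilon> / 3" using Cd eps by (intro divide_left_mono) auto
  then have near3: "norm (x k - xstar) \<le> \<epsilon> / 3" using near by linarith
  have xB: "x k \<in> B" using near3 eps iterate_edom by (simp add: dist_norm norm_minus_commute)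
  have in_B: "z \<in> B" if "z \<in> X" "norm (x k - z) \<le> 2 * \<epsilon> / 3" for z
    using that near3 X_edom norm_triangle_ineq4[of "x k - z" "x k - xstar"]
    by (auto simp: dist_norm norm_minus_commute)
  \<comment> \<open>At distance zero there would be points of \<open>X\<close> arbitrarily close to
    \<open>x k\<close>, and the Lipschitz bound would force the residual to vanish. Positivity makes
    \<open>2 * D\<close> exceed the infimum.\<close>
  have Dpos: "0 < D"
  proof (rule ccontr)
    assume "\<not> 0 < D"
    moreover have "0 < r / Lr" using r Lr by (intro divide_pos_pos) auto
    ultimately have D0: "infdist (x k) X < min (2 * \<epsilon> / 3) (r / Lr)"
      using eps unfolding min_less_iff_conj D_def by linarith
    obtain z where z: "z \<in> X" "norm (x k - z) < min (2 * \<epsilon> / 3) (r / Lr)"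
      by (rule infdist_less_obtains[OF D0])
    have "r \<le> Lr * norm (x k - z)" unfolding r_def
      using z by (intro residual_le xB in_B) auto
    moreover have "Lr * norm (x k - z) < r" using z Lr by (simp add: pos_less_divide_eq mult.commute)
    ultimately show False by linarith
  qed
  have "infdist (x k) X < 2 * D" using Dpos by (simp add: D_def)
  then obtain z where z: "z \<in> X" "norm (x k - z) < 2 * D" by (rule infdist_less_obtains)
  define t where "t = norm (x k - z)"
  have t: "0 \<le> t" "t \<le> 2 * D" using z by (auto simp: t_def)
  have DX: "D \<le> norm (x k - xstar)" unfolding D_def by (rule infdist_le_xstar)
  have zB: "z \<in> B" using z DX near3 by (intro in_B) auto
  have "\<beta> * D \<le> r powr p" unfolding D_def r_def by (rule error_bound[OF xB])
  moreover have "\<beta> * t \<le> \<beta> * (2 * D)" using t beta by (intro mult_left_mono) auto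
  ultimately have "\<beta> * t \<le> 2 * r powr p" by simp
  then have tp: "t \<le> E * r powr p" using beta by (simp add: E_def field_simps)
  have td: "t \<le> E * r powr \<delta>"
  proof -
    have "r powr p \<le> r powr \<delta>" using r p_gt by (intro powr_mono') auto
    then have "E * r powr p \<le> E * r powr \<delta>" using E_nonneg by (rule mult_left_mono)
    then show ?thesis using tp by linarith
  qed
  interpret newton_step A b \<psi> \<phi> c\<^sub>1 c\<^sub>2 \<sigma>\<^sub>1 \<sigma>\<^sub>2 \<eta> \<theta> \<alpha> a \<nu>_min \<nu>_bar \<delta> \<tau> p_min \<kappa> x xhat \<nu> rbar xstar \<epsilon> C \<beta> p k z
    using k xB zB z r1 td by unfold_locales (auto simp: r_def t_def)
  have d: "norm (d k) \<le> Cd * t" using step_bound by (simp add: t_def)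
  have d2: "norm (d k) \<le> 2 * Cd * D"
  proof -
    have "Cd * t \<le> Cd * (2 * D)" using t Cd by (intro mult_left_mono) auto
    then show ?thesis using d by (simp add: mult_ac)
  qed
  \<comment> \<open>The radius \<open>\<epsilon> / (3 * Cd)\<close> is made for this: the step has
    length at most \<open>2 * \<epsilon> / 3\<close> and starts within \<open>\<epsilon> / 3\<close>
    of \<open>xstar\<close>.\<close>
  have "xhat k \<in> cball xstar \<epsilon>"
  proof -
    have "2 * Cd * D \<le> 2 * Cd * (\<epsilon> / (3 * Cd))"
      using DX near Cd by (intro mult_left_mono) auto
    then have "norm (d k) \<le> 2 * Cd * (\<epsilon> / (3 * Cd))" using d2 by (rule order_trans[rotated])
    then have "norm (d k) \<le> 2 * \<epsilon> / 3" using Cd by simp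
    moreover have "norm (xhat k - xstar) \<le> norm (d k) + norm (x k - xstar)"
      using norm_triangle_ineq[of "d k" "x k - xstar"] by (simp add: d_def)
    ultimately show ?thesis using near3 by (simp add: dist_norm norm_minus_commute)
  qed
  note xh = this
  have acc: "\<not> unsuccessful k"
  proof (rule step_accepted[OF xh accept1])
    have "2 * C * Cd * norm (x k - z) \<le> 2 * C * Cd * (E * r powr p)"
      using C Cd tp by (intro mult_left_mono) (auto simp: t_def)
    also have "r powr p = r powr (p - \<delta>) * r powr \<delta>" by (simp flip: powr_add)
    also have "2 * C * Cd * (E * (r powr (p - \<delta>) * r powr \<delta>)) = (2 * C * Cd * E * r powr (p - \<delta>)) * r powr \<delta>"
      by (simp add: mult_ac)
    also have "\<dots> < (1 - c\<^sub>1) * \<nu>_min * r powr \<delta>"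
      using accept2 r by (intro mult_strict_right_mono) (auto simp: r_def)
    finally show "2 * C * Cd * norm (x k - z) < (1 - c\<^sub>1) * \<nu>_min * res k powr \<delta>" by (simp add: r_def)
  qed
  then have xS: "x (Suc k) = xhat k" by (simp add: x_Suc)
  then show "norm (x (Suc k) - x k) \<le> 2 * Cd * infdist (x k) X" using d2 by (simp add: d_def D_def)
  have nb: "res (Suc k) \<le> r powr (1 + \<tau>) + Cr * (r powr \<delta> * t)"
    using new_residual_bound[OF xh] by (simp add: xS r_def t_def)
  show rs: "res (Suc k) \<le> Cs * res k powr s"
  proof -
    have 1: "r powr (1 + \<tau>) \<le> r powr s" using r by (intro powr_mono') (auto simp: s_def)
    have "r powr \<delta> * t \<le> r powr \<delta> * (E * r powr p)" by (intro mult_left_mono tp) auto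
    also have "\<dots> = E * r powr (\<delta> + p)" by (simp add: powr_add)
    also have "\<dots> \<le> E * r powr s" using r E_nonneg by (intro mult_left_mono powr_mono') (auto simp: s_def)
    finally have "Cr * (r powr \<delta> * t) \<le> Cr * (E * r powr s)" using Cr by (intro mult_left_mono)
    then show ?thesis using nb 1 by (simp add: Cs_def r_def algebra_simps)
  qed
  have "res k powr s = res k powr (s - 1) * res k powr 1" by (simp only: powr_add[symmetric]) simp
  then have "Cs * res k powr s = (Cs * res k powr (s - 1)) * res k" using r by (simp add: r_def)
  also have "\<dots> \<le> \<eta> * res k" by (intro mult_right_mono decrease) auto
  finally have "res (Suc k) \<le> \<eta> * rbar k" using rs in_K_D(1)[OF nonzero k] by simp
  then show "Suc k \<in> K" by (simp add: K_def)
  have "res (Suc k) \<le> Cl * t powr (1 + \<delta>)"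
  proof -
    have rt: "r \<le> Lr * t" using r_le by (simp add: r_def t_def)
    have rd: "r powr \<delta> \<le> Lr powr \<delta> * t powr \<delta>"
      using powr_mono2[OF _ _ rt, of \<delta>] r delta Lr t by (simp add: powr_mult)
    have "r powr (1 + \<tau>) \<le> r powr \<delta> * (Lr * t)"
      using powr_tau_le mult_left_mono[OF rt powr_ge_zero, of r \<delta>] by (simp add: r_def)
    then have "res (Suc k) \<le> (Lr + Cr) * (r powr \<delta> * t)" using nb by (simp add: algebra_simps)
    also have "\<dots> \<le> (Lr + Cr) * ((Lr powr \<delta> * t powr \<delta>) * t)"
      using Lr Cr t by (intro mult_left_mono mult_right_mono rd) auto
    also have "\<dots> = Cl * (t powr \<delta> * t powr 1)" using t by (simp add: Cl_def mult_ac)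
    also have "\<dots> = Cl * t powr (1 + \<delta>)" by (simp only: powr_add[symmetric] add.commute)
    finally show ?thesis .
  qed
  also have "\<dots> \<le> Cl * (2 * D) powr (1 + \<delta>)"
    using Cl t delta by (intro mult_left_mono powr_mono2) auto
  also have "\<dots> = (Cl * 2 powr (1 + \<delta>)) * D powr (1 + \<delta>)" using Dpos by (simp add: powr_mult mult_ac)
  finally have "res (Suc k) powr p \<le> ((Cl * 2 powr (1 + \<delta>)) * D powr (1 + \<delta>)) powr p"
    using p_pos by (intro powr_mono2) auto
  also have "\<dots> = (Cl * 2 powr (1 + \<delta>)) powr p * D powr ((1 + \<delta>) * p)"
    using Cl by (simp add: powr_mult powr_powr)
  finally have "\<beta> * infdist (x (Suc k)) X \<le> (Cl * 2 powr (1 + \<delta>)) powr p * D powr ((1 + \<delta>) * p)"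
    using error_bound[of "x (Suc k)"] xh iterate_edom[of "Suc k"] by (simp add: xS)
  then show "infdist (x (Suc k)) X \<le> Cdist * infdist (x k) X powr ((1 + \<delta>) * p)"
    using beta by (simp add: Cdist_def D_def field_simps)
qed

text \<open>All smallness conditions on the residual become one radius, because the residual is at
  most \<open>Lr\<close> times the distance to \<open>xstar\<close>. The halving of the distance to
  \<open>X\<close> holds since the exponent \<open>(1 + \<delta>) * p\<close> exceeds
  \<open>1\<close>.\<close>

lemma local_convergence:
  obtains \<omega> where "\<omega> > 0" "\<And>k. k \<in> K \<Longrightarrow> norm (x k - xstar) \<le> \<omega> \<Longrightarrow>
    Suc k \<in> K \<and> norm (x (Suc k) - x k) \<le> 2 * Cd * infdist (x k) X \<and>
    res (Suc k) \<le> Cs * res k powr s \<and>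
    infdist (x (Suc k)) X \<le> Cdist * infdist (x k) X powr ((1 + \<delta>) * p) \<and>
    infdist (x (Suc k)) X \<le> infdist (x k) X / 2 \<and> res k \<le> Lr * norm (x k - xstar)"
proof -
  obtain s1 where s1: "s1 > 0" "\<And>r. 0 \<le> r \<Longrightarrow> r < s1 \<Longrightarrow> r powr (\<kappa> - 1 - \<delta>) < \<nu>_min / (2 * (2 + CG) * p_min)"
    using powr_eventually_small[of "\<kappa> - 1 - \<delta>" "\<nu>_min / (2 * (2 + CG) * p_min)"] kappa nu CG p_min by auto
  obtain s2 where s2: "s2 > 0" "\<And>r. 0 \<le> r \<Longrightarrow> r < s2 \<Longrightarrow> r powr (p - \<delta>) < (1 - c\<^sub>1) * \<nu>_min / (2 * C * Cd * E)"
    using powr_eventually_small[of "p - \<delta>" "(1 - c\<^sub>1) * \<nu>_min / (2 * C * Cd * E)"] p_gt nu C Cd c beta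
    by (auto simp: E_def)
  obtain s3 where s3: "s3 > 0" "\<And>r. 0 \<le> r \<Longrightarrow> r < s3 \<Longrightarrow> r powr (s - 1) < \<eta> / Cs"
    using powr_eventually_small[of "s - 1" "\<eta> / Cs"] s_gt_1 eta Cs by auto
  obtain s4 where s4: "s4 > 0" "\<And>r. 0 \<le> r \<Longrightarrow> r < s4 \<Longrightarrow> r powr ((1 + \<delta>) * p - 1) < 1 / (2 * Cdist)"
    using powr_eventually_small[of "(1 + \<delta>) * p - 1" "1 / (2 * Cdist)"] rate_gt_1 Cdist by auto
  \<comment> \<open>The halves in \<open>s4 / 2\<close> and in the divisor \<open>2 * Lr\<close>
    turn the weak bound by \<open>\<omega>\<close> into the strict inequalities required of the
    thresholds.\<close>
  define \<omega> where "\<omega> = min (\<epsilon> / (3 * Cd)) (min (s4 / 2) (min 1 (min s1 (min s2 s3)) / (2 * Lr)))"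
  have om: "\<omega> > 0" using eps Cd s1(1) s2(1) s3(1) s4(1) Lr by (auto simp: \<omega>_def)
  show thesis
  proof (rule that[OF om])
    fix k assume k: "k \<in> K" and near: "norm (x k - xstar) \<le> \<omega>"
    have near1: "norm (x k - xstar) \<le> \<epsilon> / (3 * Cd)" using near by (simp add: \<omega>_def)
    have "\<epsilon> / (3 * Cd) \<le> \<epsilon>" using Cd eps by (simp add: pos_divide_le_eq)
    then have xB: "x k \<in> B" using near1 iterate_edom by (simp add: dist_norm norm_minus_commute)
    have xs: "xstar \<in> B" using xstar X_edom eps by auto
    have rl: "res k \<le> Lr * norm (x k - xstar)" by (rule residual_le[OF xB xs xstar])
    have "norm (x k - xstar) \<le> min 1 (min s1 (min s2 s3)) / (2 * Lr)" using near by (simp add: \<omega>_def)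
    then have "2 * (Lr * norm (x k - xstar)) \<le> min 1 (min s1 (min s2 s3))"
      using Lr by (simp add: pos_le_divide_eq mult_ac)
    moreover have "0 < min 1 (min s1 (min s2 s3))" using s1 s2 s3 by simp
    ultimately have "res k < min 1 (min s1 (min s2 s3))" using rl by linarith
    then have r: "res k \<le> 1" "res k < s1" "res k < s2" "res k < s3" by auto
    have "2 * (2 + CG) * p_min * res k powr (\<kappa> - 1 - \<delta>) < \<nu>_min"
      using s1(2)[OF norm_ge_zero r(2)] CG p_min by (simp add: pos_less_divide_eq mult_ac)
    moreover have "2 * C * Cd * E * res k powr (p - \<delta>) < (1 - c\<^sub>1) * \<nu>_min"
    proof -
      have "0 < 2 * C * Cd * E" using C Cd beta by (simp add: E_def)
      then show ?thesis using s2(2)[OF norm_ge_zero r(3)] by (simp add: pos_less_divide_eq mult_ac)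
    qed
    moreover have "Cs * res k powr (s - 1) \<le> \<eta>"
      using s3(2)[OF norm_ge_zero r(4)] Cs by (simp add: pos_less_divide_eq mult_ac)
    ultimately have est: "Suc k \<in> K" "norm (x (Suc k) - x k) \<le> 2 * Cd * infdist (x k) X"
      "res (Suc k) \<le> Cs * res k powr s" "infdist (x (Suc k)) X \<le> Cdist * infdist (x k) X powr ((1 + \<delta>) * p)"
      using iteration_estimates[OF k near1 r(1)] by blast+
    have "infdist (x k) X \<le> s4 / 2" using infdist_le_xstar[of "x k"] near by (simp add: \<omega>_def)
    then have "infdist (x k) X < s4" using s4(1) by linarith
    from s4(2)[OF infdist_nonneg this]
    have "Cdist * infdist (x k) X powr ((1 + \<delta>) * p - 1) * infdist (x k) X \<le> 1 / 2 * infdist (x k) X"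
      using Cdist by (intro mult_right_mono) (simp_all add: pos_less_divide_eq infdist_nonneg mult_ac)
    moreover have "infdist (x k) X powr ((1 + \<delta>) * p) = infdist (x k) X powr ((1 + \<delta>) * p - 1) * infdist (x k) X"
    proof -
      have "infdist (x k) X powr ((1 + \<delta>) * p) = infdist (x k) X powr ((1 + \<delta>) * p - 1) * infdist (x k) X powr 1"
        by (simp only: powr_add[symmetric]) simp
      then show ?thesis by (simp add: infdist_nonneg)
    qed
    ultimately have "infdist (x (Suc k)) X \<le> infdist (x k) X / 2" using est(4) by (simp add: mult_ac)
    then show "Suc k \<in> K \<and> norm (x (Suc k) - x k) \<le> 2 * Cd * infdist (x k) X \<and>
      res (Suc k) \<le> Cs * res k powr s \<and>
      infdist (x (Suc k)) X \<le> Cdist * infdist (x k) X powr ((1 + \<delta>) * p) \<and>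
      infdist (x (Suc k)) X \<le> infdist (x k) X / 2 \<and> res k \<le> Lr * norm (x k - xstar)"
      using est rl by blast
  qed
qed

text \<open>The potential \<open>norm (x k - xstar) + 4 * Cd * infdist (x k) X\<close> does not increase, because the
  halving of the second term pays for the length of the step.\<close>

theorem superlinear_convergence:
  assumes acc: "accumulation_point_along x K xstar"
  shows "x \<longlonglongrightarrow> xstar" "converges_to_0_at_rate res s"
    "converges_to_0_at_rate (\<lambda>k. infdist (x k) X) ((1 + \<delta>) * p)"
proof -
  obtain \<omega> where om: "\<omega> > 0" and step: "\<And>k. k \<in> K \<Longrightarrow> norm (x k - xstar) \<le> \<omega> \<Longrightarrow>
    Suc k \<in> K \<and> norm (x (Suc k) - x k) \<le> 2 * Cd * infdist (x k) X \<and>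
    res (Suc k) \<le> Cs * res k powr s \<and>
    infdist (x (Suc k)) X \<le> Cdist * infdist (x k) X powr ((1 + \<delta>) * p) \<and>
    infdist (x (Suc k)) X \<le> infdist (x k) X / 2 \<and> res k \<le> Lr * norm (x k - xstar)"
    using local_convergence by blast
  define \<Phi> where "\<Phi> k = norm (x k - xstar) + 4 * Cd * infdist (x k) X" for k
  have Phi_ge: "norm (x k - xstar) \<le> \<Phi> k" for k
    using Cd by (simp add: \<Phi>_def infdist_nonneg)
  have tail: "\<exists>N. \<forall>k\<ge>N. k \<in> K \<and> \<Phi> k \<le> e" if e: "0 < e" "e \<le> \<omega>" for e
  proof -
    obtain j where j: "strict_mono j" "range j \<subseteq> K" "(x \<circ> j) \<longlonglongrightarrow> xstar"
      using acc by (auto simp: accumulation_point_along_def)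
    \<comment> \<open>\<open>infdist (x N) X\<close> is at most the distance to
      \<open>xstar\<close>, so \<open>\<Phi> N\<close> is at most \<open>1 + 4 * Cd\<close> times
      that distance; one iterate of the subsequence this close starts the induction.\<close>
    have "0 < e / (1 + 4 * Cd)" using e Cd by simp
    with j(3) obtain n where "norm ((x \<circ> j) n - xstar) < e / (1 + 4 * Cd)"
      unfolding LIMSEQ_iff by blast
    then obtain N where N: "N \<in> K" "norm (x N - xstar) * (1 + 4 * Cd) < e"
      using j(2) Cd by (auto simp: pos_less_divide_eq)
    have "4 * Cd * infdist (x N) X \<le> 4 * Cd * norm (x N - xstar)"
      using Cd by (intro mult_left_mono infdist_le_xstar) auto
    then have N2: "\<Phi> N \<le> e" using N by (simp add: \<Phi>_def algebra_simps)
    have "k \<in> K \<and> \<Phi> k \<le> e" if "k \<ge> N" for k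
      using that
    proof (induction k rule: dec_induct)
      case base then show ?case using N N2 by blast
    next
      case (step k)
      have "norm (x k - xstar) \<le> \<omega>" using step.IH e Phi_ge[of k] by linarith
      note st = \<open>\<And>k. k \<in> K \<Longrightarrow> norm (x k - xstar) \<le> \<omega> \<Longrightarrow> _\<close>[OF conjunct1[OF step.IH] this]
      have "norm (x (Suc k) - xstar) \<le> norm (x (Suc k) - x k) + norm (x k - xstar)"
        using norm_triangle_ineq[of "x (Suc k) - x k" "x k - xstar"] by simp
      moreover have "4 * Cd * infdist (x (Suc k)) X \<le> 4 * Cd * (infdist (x k) X / 2)"
        using st Cd by (intro mult_left_mono) auto
      ultimately have "\<Phi> (Suc k) \<le> \<Phi> k" using st by (simp add: \<Phi>_def)
      then show ?case using st step.IH by auto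
    qed
    then show ?thesis by blast
  qed
  show lim: "x \<longlonglongrightarrow> xstar"
    unfolding LIMSEQ_iff
  proof (intro allI impI)
    fix e :: real assume "0 < e"
    then obtain N where N: "\<forall>k\<ge>N. k \<in> K \<and> \<Phi> k \<le> min (e / 2) \<omega>" using tail[of "min (e / 2) \<omega>"] om by auto
    have "norm (x k - xstar) < e" if "k \<ge> N" for k
      using N that Phi_ge[of k] \<open>0 < e\<close> by fastforce
    then show "\<exists>N. \<forall>k\<ge>N. norm (x k - xstar) < e" by blast
  qed
  \<comment> \<open>From \<open>N\<close> on every index lies in \<open>K\<close> and every iterate
    within \<open>\<omega>\<close> of \<open>xstar\<close>, so the one-step estimates hold for all
    later \<open>k\<close> and not only along a subsequence.\<close>
  obtain N where N: "\<And>k. k \<ge> N \<Longrightarrow> k \<in> K \<and> \<Phi> k \<le> \<omega>" using tail[of \<omega>] om by auto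
  have st: "res (Suc k) \<le> Cs * res k powr s \<and>
    infdist (x (Suc k)) X \<le> Cdist * infdist (x k) X powr ((1 + \<delta>) * p) \<and>
    res k \<le> Lr * norm (x k - xstar)" if "k \<ge> N" for k
    using step[of k] N[OF that] Phi_ge[of k] by auto
  have n0: "(\<lambda>k. norm (x k - xstar)) \<longlonglongrightarrow> 0" using lim by (simp add: LIM_zero tendsto_norm_zero)
  then have n1: "(\<lambda>k. Lr * norm (x k - xstar)) \<longlonglongrightarrow> 0" by (rule tendsto_mult_right_zero)
  have "res \<longlonglongrightarrow> 0"
    by (rule tendsto_sandwich[OF _ _ tendsto_const n1])
      (use st in \<open>auto intro!: always_eventually eventually_sequentiallyI[of N]\<close>)
  then show "converges_to_0_at_rate res s"
    unfolding converges_to_0_at_rate_def using Cs st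
    by (auto intro!: exI[of _ Cs] eventually_sequentiallyI[of N])
  have "(\<lambda>k. infdist (x k) X) \<longlonglongrightarrow> 0"
    by (rule tendsto_sandwich[OF _ _ tendsto_const n0])
      (auto intro!: always_eventually infdist_nonneg infdist_le_xstar)
  then show "converges_to_0_at_rate (\<lambda>k. infdist (x k) X) ((1 + \<delta>) * p)"
    unfolding converges_to_0_at_rate_def using Cdist st
    by (auto intro!: exI[of _ Cdist] eventually_sequentiallyI[of N])
qed

end

section \<open>The local analysis applied to the given run\<close>

theorem corollary19:
  fixes A :: "real^'n^'m" and b :: "real^'m"
    and \<psi> :: "real^'m \<Rightarrow> ereal" and \<phi> :: "real^'n \<Rightarrow> ereal"
    and c\<^sub>1 c\<^sub>2 \<sigma>\<^sub>1 \<sigma>\<^sub>2 \<eta> \<theta> \<alpha> a \<nu>_min \<nu>_bar \<delta> \<tau> p_min \<kappa> :: real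
    and x xhat :: "nat \<Rightarrow> real^'n" and \<nu> rbar :: "nat \<Rightarrow> real"
    and xstar :: "real^'n" and \<epsilon> L\<^sub>\<psi> \<beta> q :: real
  defines "r \<equiv> composite_data.residual A b \<psi> \<phi>"
    and "X \<equiv> composite_data.strongly_stationary_points A b \<psi> \<phi>"
    and "hess_psi \<equiv> composite_data.hess_psi \<psi>"
  assumes run: "reg_prox_newton A b \<psi> \<phi> c\<^sub>1 c\<^sub>2 \<sigma>\<^sub>1 \<sigma>\<^sub>2 \<eta> \<theta> \<alpha> a \<nu>_min \<nu>_bar \<delta> \<tau> p_min \<kappa> x xhat \<nu> rbar"
    and not_terminated: "\<forall>k. r (x k) \<noteq> 0"
    and X_nonempty: "X \<noteq> {}"
    and xstar: "xstar \<in> X"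
      "accumulation_point_along x (newton_data.K A b \<psi> \<phi> \<eta> x rbar) xstar"
    and eps: "\<epsilon> > 0"
    and hess_lipschitz: "L\<^sub>\<psi> > 0"
      "\<forall>y \<in> cball xstar \<epsilon> \<inter> edom \<phi>. \<forall>z \<in> cball xstar \<epsilon> \<inter> edom \<phi>.
         spectral_norm (hess_psi (A *v y - b) - hess_psi (A *v z - b))
           \<le> L\<^sub>\<psi> * norm (A *v y - A *v z)"
    and error_bound: "\<beta> > 0" "q > max \<delta> (1 - \<delta>)"
      "\<forall>y \<in> cball xstar \<epsilon> \<inter> edom \<phi>. \<beta> * infdist y X \<le> norm (r y) powr q"
    and q: "q > 1 / (1 + \<delta>)"
  shows "x \<longlonglongrightarrow> xstar \<and>
    min (1 + \<tau>) (\<delta> + q) > 1 \<and>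
    converges_to_0_at_rate (\<lambda>k. norm (r (x k))) (min (1 + \<tau>) (\<delta> + q)) \<and>
    (1 + \<delta>) * q > 1 \<and>
    converges_to_0_at_rate (\<lambda>k. infdist (x k) X) ((1 + \<delta>) * q)"
proof -
  interpret rn: reg_prox_newton A b \<psi> \<phi> c\<^sub>1 c\<^sub>2 \<sigma>\<^sub>1 \<sigma>\<^sub>2 \<eta> \<theta> \<alpha> a \<nu>_min \<nu>_bar \<delta> \<tau> p_min \<kappa> x xhat \<nu> rbar
    by (rule run)
  let ?B = "cball xstar \<epsilon> \<inter> edom \<phi>"
  have xs: "xstar \<in> ?B"
    using xstar(1) eps by (auto simp: X_def rn.strongly_stationary_points_def rn.stationary_def)
  \<comment> \<open>\<open>local_bounds\<close> is used on the ball intersected with the domain,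
    with \<open>xstar\<close> as its reference point.\<close>
  obtain C where "C \<ge> 1"
    and "\<forall>y\<in>?B. \<forall>z\<in>?B. \<forall>v. norm (rn.hess_f y *v v - rn.hess_f z *v v) \<le> C * norm (y - z) * norm v"
    and "\<forall>y\<in>?B. \<forall>v. norm (rn.hess_f y *v v) \<le> C * norm v"
    and "\<forall>y\<in>?B. \<forall>z\<in>?B. \<forall>v. psd (rn.hess_psi (A *v z - b)) \<longrightarrow>
       max 0 (- lambda_min (rn.hess_psi (A *v y - b))) * norm ((transpose A ** A) *v v) \<le> C * norm (y - z) * norm v"
    using rn.local_bounds[OF _ xs _ hess_lipschitz(1), of \<epsilon>] hess_lipschitz(2)
    by (auto simp: hess_psi_def dist_norm norm_minus_commute)
  then interpret near: newton_near_solution A b \<psi> \<phi> c\<^sub>1 c\<^sub>2 \<sigma>\<^sub>1 \<sigma>\<^sub>2 \<eta> \<theta> \<alpha> a \<nu>_min \<nu>_bar \<delta> \<tau> p_min \<kappa>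
      x xhat \<nu> rbar xstar \<epsilon> C \<beta> q
    using not_terminated xstar(1) eps error_bound q
    by unfold_locales (auto simp: r_def X_def)
  show ?thesis
    using near.superlinear_convergence[OF xstar(2)] near.s_gt_1 near.rate_gt_1
    by (simp add: r_def X_def near.s_def)
qed

end
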